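(* Assume that $K_n\to\infty$ as $n\to\infty$, and let $\rho(X^n)$ be the spectral radius of $X^n$. Then for every $\varepsilon>0$, $$\mathbb P\left(\rho(X^n)>1+\varepsilon\right)\xrightarrow[n\to\infty]{}0 .$$
   Context: Let $\chi$ be a complex-valued random variable with $\mathbb{E}\chi=0$ and $\mathbb{E}|\chi|^2=1$. For each $n\ge1$, $A^n=(A^n_{ij})_{i,j=1}^n$ is a random matrix with i.i.d. entries distributed as $\chi$. $(K_n)$ is a sequence of positive integers with $K_n\le n$; $B^n=(B^n_{ij})$ is an $n\times n$ matrix with i.i.d. Bernoulli ($\{0,1\}$-valued) entries with $\mathbb P(B^n_{11}=1)=K_n/n$, independent of $A^n$. The $n\times n$ matrix $X^n$ has entries $X^n_{ij}=\frac1{\sqrt{K_n}}B^n_{ij}A^n_{ij}$. *)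

theory Defs
  imports "HOL-Probability.Probability" "Jordan_Normal_Form.Spectral_Radius"
begin

(* Rows and columns of an n x n matrix are numbered from 0 to n - 1. *)
definition entries :: "nat \<Rightarrow> (nat \<times> nat) set" where
  "entries n = {..<n} \<times> {..<n}"

definition sparse_mat ::
  "nat \<Rightarrow> nat \<Rightarrow> (nat \<Rightarrow> nat \<Rightarrow> complex) \<Rightarrow> (nat \<Rightarrow> nat \<Rightarrow> complex) \<Rightarrow> complex mat" where
  "sparse_mat n k b a =
     mat n n (\<lambda>(i, j). 1 / complex_of_real (sqrt (real k)) * b i j * a i j)"

(* The law of a {0,1}-valued variable that equals 1 with probability p. It lives on the complex
   numbers because indep_var needs both random elements to have the same type. *)
definition bernoulli_law :: "real \<Rightarrow> complex measure" where
  "bernoulli_law p = distr (measure_pmf (bernoulli_pmf p)) borel of_bool"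

(* The array of entries as one random element of the product space over entries n. *)
definition array :: "nat \<Rightarrow> (nat \<Rightarrow> nat \<Rightarrow> 'a \<Rightarrow> complex) \<Rightarrow> 'a \<Rightarrow> (nat \<times> nat \<Rightarrow> complex)" where
  "array n Y \<omega> = restrict (\<lambda>(i, j). Y i j \<omega>) (entries n)"

end

(* With q(z) = det(1 - z X), an eigenvalue of modulus > 1 + eps is a zero of q in |z| < r = 1 / (1 + eps) < 1.
   Let X' be X with truncated and recentred entries, q' = det(1 - z X') and T_k = tr X'^k. The coefficients of q, q'
   and q - q' are sums of pairwise orthogonal monomials; so those of q' are bounded in L^2, and those of q - q' are
   small in L^2 by the Lindeberg condition, which holds because K_n tends to infinity. The truncated entries have all
   moments of order >= 2 bounded by 1 / n, and counting pairs of closed walks gives E|T_k|^2 <= 3 k^3 for large n: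
   in the limit only those pairs of walks survive in which every visited vertex has a single successor. By Newton's
   identities the function q'(z) exp(sum_{k <= m} T_k z^k / k) has derivative O(z^m), hence it is close to 1 on the
   disc of radius r, with high probability. Multiplied by the same exponential, q is then close to 1 as well and
   does not vanish there. *)
theory Submission
  imports Defs "HOL-Computational_Algebra.Polynomial_FPS" "HOL-Number_Theory.Cong" "HOL-Real_Asymp.Real_Asymp"
begin

section \<open>The reverse characteristic polynomial\<close>

text \<open>Only two moments of \<open>\<xi>\<close> are available, so tr X^k, in which entries
  repeat, need not have a second moment. The coefficients of q do, because every monomial in them is
  square-free. Hence coefficients are compared between X and X', whereas traces are taken of X'
  alone. L^2 bounds on the coefficients do not by themselves exclude zeros. The exponential factor
  works because sum_k T_k z^k / k is the power series of -log q', so its partial sums cancel the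
  Taylor coefficients of q' one by one. The parameters are fixed in the order L, m, n. The
  expectation of S = sum_{k <= m} |T_k| r^k / k is bounded uniformly in m, so S < L can be arranged
  before m is known. Then m is chosen so large that the remaining Taylor coefficients are small
  compared with exp (- L). Last comes n: the count of walk pairs has a remainder 2^(4 k^2) / n,
  which is controlled for the finitely many k <= m, and the Lindeberg quantity must be small
  compared with exp (- L) as well.\<close>

definition partial_perms :: "nat \<Rightarrow> nat \<Rightarrow> (nat set \<times> (nat \<Rightarrow> nat)) set" where
  "partial_perms n k = (SIGMA I:{I. I \<subseteq> {0..<n} \<and> card I = k}. {p. p permutes I})"

text \<open>The coefficient of z^k in det(1 - z X): up to sign, the sum of the principal k x k
  minors. Each permutation is paired with an index set \<open>I\<close>, so that a fixed point
  inside \<open>I\<close> stands for a diagonal entry of X and a fixed point outside for the 1 of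
  the identity matrix.\<close>

definition rev_char_coeff :: "nat \<Rightarrow> (nat \<times> nat \<Rightarrow> complex) \<Rightarrow> nat \<Rightarrow> complex" where
  "rev_char_coeff n x k = (\<Sum>(I, p)\<in>partial_perms n k. (-1) ^ k * signof p * (\<Prod>i\<in>I. x (i, p i)))"

lemma finite_partial_perms: "finite (partial_perms n k)"
  unfolding partial_perms_def
  by (intro finite_SigmaI) (auto intro: finite_permutations finite_subset)

text \<open>The exact number is a falling factorial. The bound n^k offsets the second moment, at
  most n^(-k), of a monomial with k distinct entries.\<close>

lemma card_partial_perms: "card (partial_perms n k) \<le> n ^ k"
proof -
  have fin: "finite {I. I \<subseteq> {0..<n} \<and> card I = k}" by auto
  have "card (partial_perms n k) = (\<Sum>I\<in>{I. I \<subseteq> {0..<n} \<and> card I = k}. card {p. p permutes I})"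
    unfolding partial_perms_def by (intro card_SigmaI fin) (auto intro: finite_permutations finite_subset)
  also have "\<dots> = (\<Sum>I\<in>{I. I \<subseteq> {0..<n} \<and> card I = k}. fact k)"
    by (intro sum.cong card_permutations) (auto intro: finite_subset)
  also have "\<dots> = (n choose k) * fact k"
    by (simp add: n_subsets)
  also have "\<dots> \<le> n ^ k"
    using binomial_fact_pow by (simp add: mult.commute)
  finally show ?thesis .
qed

lemma rev_char_coeff_0 [simp]: "rev_char_coeff n x 0 = 1"
proof -
  have "{I. I \<subseteq> {0..<n} \<and> card I = 0} = {{}}" 
    using finite_subset[of _ "{0..<n}"] by fastforce
  moreover have "(SIGMA I:{{}}. {p :: nat \<Rightarrow> nat. p permutes I}) = {({}, id)}"
    by auto
  ultimately have "partial_perms n 0 = {({}, id)}"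
    unfolding partial_perms_def by (simp only:)
  then show ?thesis
    by (simp add: rev_char_coeff_def)
qed

lemma rev_char_coeff_eq_0: 
  assumes "k > n"
  shows "rev_char_coeff n x k = 0"
proof -
  have "card I \<noteq> k" if "I \<subseteq> {0..<n}" for I
    using card_mono[OF _ that] assms by simp
  then have "{I. I \<subseteq> {0..<n} \<and> card I = k} = {}" by blast
  then have "partial_perms n k = {}"
    unfolding partial_perms_def by (simp only: Sigma_empty1)
  then show ?thesis by (simp add: rev_char_coeff_def)
qed

lemma permutes_subset_iff:
  assumes "I \<subseteq> U"
  shows "p permutes I \<longleftrightarrow> p permutes U \<and> (\<forall>i\<in>U - I. p i = i)"
  using assms permutes_subset[of p I U] permutes_superset[of p U I] 
  by (auto simp: permutes_not_in)

text \<open>Every factor of a permutation term is \<open>- z * x (i, p i)\<close> plus a Kronecker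
  delta. If the first summand is chosen on \<open>I\<close> and the delta elsewhere, the term
  vanishes unless \<open>p\<close> fixes the complement of \<open>I\<close>, that is, unless
  \<open>p\<close> permutes \<open>I\<close>.\<close>

lemma det_one_minus_smult:
  "det (1\<^sub>m n - z \<cdot>\<^sub>m mat n n x) = (\<Sum>k\<le>n. rev_char_coeff n x k * z ^ k)"
proof -
  let ?U = "{0..<n}"
  let ?\<delta> = "\<lambda>p i. if p i = i then 1 else 0 :: complex"
  define F where "F I p = signof p * (\<Prod>i\<in>I. - z * x (i, p i))" for I and p :: "nat \<Rightarrow> nat"
  have "det (1\<^sub>m n - z \<cdot>\<^sub>m mat n n x) =
      (\<Sum>p | p permutes ?U. signof p * (\<Prod>i=0..<n. (1\<^sub>m n - z \<cdot>\<^sub>m mat n n x) $$ (i, p i)))"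
    by (rule det_def') auto
  also have "\<dots> = (\<Sum>p | p permutes ?U. signof p * (\<Prod>i=0..<n. - z * x (i, p i) + ?\<delta> p i))"
  proof (intro sum.cong refl)
    fix p assume p: "p \<in> {p. p permutes ?U}"
    have "(1\<^sub>m n - z \<cdot>\<^sub>m mat n n x) $$ (i, p i) = - z * x (i, p i) + ?\<delta> p i" if "i \<in> ?U" for i
    proof -
      have "p i < n" using permutes_in_image[of p ?U i] p that by simp
      with that show ?thesis by auto
    qed
    then show "signof p * (\<Prod>i=0..<n. (1\<^sub>m n - z \<cdot>\<^sub>m mat n n x) $$ (i, p i)) =
        signof p * (\<Prod>i=0..<n. - z * x (i, p i) + ?\<delta> p i)"
      by (metis (no_types, lifting) prod.cong)
  qed
  also have "\<dots> = (\<Sum>p | p permutes ?U. \<Sum>I\<in>Pow ?U. if p permutes I then F I p else 0)"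
  proof (intro sum.cong refl)
    fix p assume "p \<in> {p. p permutes ?U}"
    then have p: "p permutes ?U" by simp
    have "signof p * ((\<Prod>i\<in>I. - z * x (i, p i)) * (\<Prod>i\<in>?U - I. ?\<delta> p i)) =
        (if p permutes I then F I p else 0)" if I: "I \<in> Pow ?U" for I
    proof (cases "p permutes I")
      case True
      then have "(\<Prod>i\<in>?U - I. ?\<delta> p i) = 1"
        by (intro prod.neutral) (auto simp: permutes_not_in)
      with True show ?thesis by (simp add: F_def)
    next
      case False
      then obtain i where "i \<in> ?U - I" "p i \<noteq> i"
        using permutes_subset_iff[of I ?U p] I p by auto
      then have "(\<Prod>i\<in>?U - I. ?\<delta> p i) = 0"
        by (intro prod_zero bexI[of _ i]) auto
      with False show ?thesis by simp
    qed
    then show "signof p * (\<Prod>i=0..<n. - z * x (i, p i) + ?\<delta> p i) =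
        (\<Sum>I\<in>Pow ?U. if p permutes I then F I p else 0)"
      unfolding prod_add[OF finite_atLeastLessThan] sum_distrib_left by (intro sum.cong refl)
  qed
  also have "\<dots> = (\<Sum>I\<in>Pow ?U. \<Sum>p | p permutes ?U. if p permutes I then F I p else 0)"
    by (rule sum.swap)
  also have "\<dots> = (\<Sum>I\<in>Pow ?U. \<Sum>p | p permutes I. F I p)"
  proof (rule sum.cong[OF refl])
    fix I assume "I \<in> Pow ?U"
    then show "(\<Sum>p | p permutes ?U. if p permutes I then F I p else 0) = (\<Sum>p | p permutes I. F I p)"
      by (intro sum.mono_neutral_cong_right) (auto intro: finite_permutations permutes_subset)
  qed
  also have "\<dots> = (\<Sum>k\<le>n. \<Sum>I\<in>{I\<in>Pow ?U. card I = k}. \<Sum>p | p permutes I. F I p)"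
    by (rule sum.group[symmetric]) (auto intro: order.trans[OF card_mono[of ?U]])
  also have "\<dots> = (\<Sum>k\<le>n. rev_char_coeff n x k * z ^ k)"
  proof (rule sum.cong[OF refl])
    fix k
    have "(\<Sum>I\<in>{I\<in>Pow ?U. card I = k}. \<Sum>p | p permutes I. F I p) =
        (\<Sum>(I, p)\<in>partial_perms n k. F I p)"
      unfolding partial_perms_def
      by (subst sum.Sigma) (auto simp: finite_permutations finite_subset[of _ ?U])
    also have "\<dots> = (\<Sum>(I, p)\<in>partial_perms n k. (-1) ^ k * signof p * (\<Prod>i\<in>I. x (i, p i)) * z ^ k)"
    proof -
      have "F I p = (-1) ^ k * signof p * (\<Prod>i\<in>I. x (i, p i)) * z ^ k"
        if "(I, p) \<in> partial_perms n k" for I p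
      proof -
        have "card I = k" using that by (auto simp: partial_perms_def)
        then have "(\<Prod>i\<in>I. - z * x (i, p i)) = (- z) ^ k * (\<Prod>i\<in>I. x (i, p i))"
          by (simp only: prod.distrib prod_constant)
        moreover have "(- z) ^ k = (-1) ^ k * z ^ k"
          by (metis mult_minus1 power_mult_distrib)
        ultimately show ?thesis by (simp add: F_def mult_ac)
      qed
      then show ?thesis by (intro sum.cong) auto
    qed
    also have "\<dots> = rev_char_coeff n x k * z ^ k"
      unfolding rev_char_coeff_def sum_distrib_right by (intro sum.cong) auto
    finally show "(\<Sum>I\<in>{I\<in>Pow ?U. card I = k}. \<Sum>p | p permutes I. F I p) = rev_char_coeff n x k * z ^ k" .
  qed
  finally show ?thesis .
qed

section \<open>Eigenvalues and Newton's identities\<close>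

lemma trace_mult_commute:
  fixes A B :: "'a::comm_semiring_0 mat"
  assumes "A \<in> carrier_mat n n" "B \<in> carrier_mat n n"
  shows "(\<Sum>i<n. (A * B) $$ (i, i)) = (\<Sum>i<n. (B * A) $$ (i, i))"
proof -
  have "(\<Sum>i<n. (A * B) $$ (i, i)) = (\<Sum>i<n. \<Sum>j<n. A $$ (i, j) * B $$ (j, i))"
    using assms by (intro sum.cong) (auto simp: scalar_prod_def lessThan_atLeast0)
  also have "\<dots> = (\<Sum>j<n. \<Sum>i<n. B $$ (j, i) * A $$ (i, j))"
    by (subst sum.swap) (simp add: mult.commute)
  also have "\<dots> = (\<Sum>i<n. (B * A) $$ (i, i))"
    using assms by (intro sum.cong) (auto simp: scalar_prod_def lessThan_atLeast0)
  finally show ?thesis .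
qed

lemma upper_triangular_pow:
  fixes B :: "'a::comm_semiring_1 mat"
  assumes B: "B \<in> carrier_mat n n" "upper_triangular B"
  shows "(\<forall>i<n. \<forall>j<i. (B ^\<^sub>m k) $$ (i, j) = 0) \<and> (\<forall>i<n. (B ^\<^sub>m k) $$ (i, i) = (B $$ (i, i)) ^ k)"
proof (induction k)
  case 0
  then show ?case using B by auto
next
  case (Suc k)
  have Bk: "B ^\<^sub>m k \<in> carrier_mat n n" using B by simp
  have entry: "(B ^\<^sub>m Suc k) $$ (i, j) = (\<Sum>l<n. (B ^\<^sub>m k) $$ (i, l) * B $$ (l, j))"
    if "i < n" "j < n" for i j
    using that B Bk by (auto simp: scalar_prod_def lessThan_atLeast0)
  have ut: "B $$ (l, j) = 0" if "j < l" "l < n" for l j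
    using that B by auto
  have "(B ^\<^sub>m Suc k) $$ (i, j) = 0" if "i < n" "j < i" for i j
  proof -
    have "(B ^\<^sub>m k) $$ (i, l) * B $$ (l, j) = 0" if "l < n" for l
      using Suc ut[of j l] that \<open>i < n\<close> \<open>j < i\<close> by (cases "l < i") auto
    then show ?thesis using entry[of i j] that by simp
  qed
  moreover have "(B ^\<^sub>m Suc k) $$ (i, i) = (B $$ (i, i)) ^ Suc k" if "i < n" for i
  proof -
    have "(\<Sum>l<n. (B ^\<^sub>m k) $$ (i, l) * B $$ (l, i)) = (\<Sum>l\<in>{i}. (B ^\<^sub>m k) $$ (i, l) * B $$ (l, i))"
    proof (intro sum.mono_neutral_right ballI)
      fix l assume l: "l \<in> {..<n} - {i}"
      show "(B ^\<^sub>m k) $$ (i, l) * B $$ (l, i) = 0"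
        using Suc ut[of i l] that l by (cases "l < i") auto
    qed (use that in auto)
    then show ?thesis using entry[of i i] that Suc by (simp add: mult.commute)
  qed
  ultimately show ?case by blast
qed

text \<open>Schur triangularisation supplies the list as the diagonal of \<open>B\<close>;
  determinant and trace are invariant under similarity and depend only on the diagonal of a
  triangular matrix. Having one list for both formulas is what links coefficients to traces.\<close>

lemma eigenvalue_list:
  fixes X :: "complex mat"
  assumes X: "X \<in> carrier_mat n n"
  obtains as where "\<And>z. det (1\<^sub>m n - z \<cdot>\<^sub>m X) = (\<Prod>a\<leftarrow>as. 1 - z * a)"
    and "\<And>k. (\<Sum>i<n. (X ^\<^sub>m k) $$ (i, i)) = (\<Sum>a\<leftarrow>as. a ^ k)"
proof -
  obtain es where es: "char_poly X = (\<Prod>a\<leftarrow>es. [:- a, 1:])"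
    using char_poly_factorized[OF X] by blast
  obtain B P Q where sd: "schur_decomposition X es = (B, P, Q)"
    by (metis prod_cases3)
  from schur_decomposition[OF X es sd]
  have wit: "similar_mat_wit X B P Q" and ut: "upper_triangular B" by auto
  note w = similar_mat_witD2[OF X wit]
  have det: "det (1\<^sub>m n - z \<cdot>\<^sub>m X) = (\<Prod>a\<leftarrow>diag_mat B. 1 - z * a)" for z
  proof -
    have "P * (1\<^sub>m n - z \<cdot>\<^sub>m B) * Q = P * 1\<^sub>m n * Q - P * (z \<cdot>\<^sub>m B) * Q"
      using w(5-7) by (subst mult_minus_distrib_mat[of _ n n _ n]) (auto simp: minus_mult_distrib_mat[of _ n n _ _ n])
    also have "\<dots> = 1\<^sub>m n - z \<cdot>\<^sub>m X"
      using w by (simp add: mult_smult_distrib[of _ n n _ n] mult_smult_assoc_mat[of _ n n _ n])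
    finally have "similar_mat_wit (1\<^sub>m n - z \<cdot>\<^sub>m X) (1\<^sub>m n - z \<cdot>\<^sub>m B) P Q"
      using w unfolding similar_mat_wit_def Let_def by auto
    then have "det (1\<^sub>m n - z \<cdot>\<^sub>m X) = det (1\<^sub>m n - z \<cdot>\<^sub>m B)"
      by (intro det_similar) (auto simp: similar_mat_def)
    also have "\<dots> = prod_list (diag_mat (1\<^sub>m n - z \<cdot>\<^sub>m B))"
      using w(5) ut by (intro det_upper_triangular upper_triangularI) (auto dest: upper_triangularD)
    also have "diag_mat (1\<^sub>m n - z \<cdot>\<^sub>m B) = map (\<lambda>a. 1 - z * a) (diag_mat B)"
      using w(5) by (auto simp: diag_mat_def)
    finally show ?thesis .
  qed
  moreover have "(\<Sum>i<n. (X ^\<^sub>m k) $$ (i, i)) = (\<Sum>a\<leftarrow>diag_mat B. a ^ k)" for k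
  proof -
    have Bk: "B ^\<^sub>m k \<in> carrier_mat n n" using w(5) by simp
    have "X ^\<^sub>m k = P * (B ^\<^sub>m k * Q)"
      using similar_mat_wit_pow_id[OF wit] w Bk by (simp add: assoc_mult_mat[of _ n n _ n _ n])
    then have "(\<Sum>i<n. (X ^\<^sub>m k) $$ (i, i)) = (\<Sum>i<n. (P * (B ^\<^sub>m k * Q)) $$ (i, i))" by simp
    also have "\<dots> = (\<Sum>i<n. (B ^\<^sub>m k * Q * P) $$ (i, i))"
      using w(6,7) Bk by (intro trace_mult_commute) auto
    also have "B ^\<^sub>m k * Q * P = B ^\<^sub>m k"
      using w Bk by (simp add: assoc_mult_mat[of _ n n _ n _ n])
    also have "(\<Sum>i<n. (B ^\<^sub>m k) $$ (i, i)) = (\<Sum>i<n. (B $$ (i, i)) ^ k)"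
      using upper_triangular_pow[OF w(5) ut, of k] by auto
    also have "\<dots> = (\<Sum>a\<leftarrow>diag_mat B. a ^ k)"
      using w(5) by (simp add: diag_mat_def interv_sum_list_conv_sum_set_nat lessThan_atLeast0 comp_def)
    finally show ?thesis .
  qed
  ultimately show ?thesis by (rule that)
qed

definition trace_pow :: "nat \<Rightarrow> (nat \<times> nat \<Rightarrow> complex) \<Rightarrow> nat \<Rightarrow> complex" where
  "trace_pow n x k = (\<Sum>i<n. (mat n n x ^\<^sub>m k) $$ (i, i))"

text \<open>This is the logarithmic derivative of the product, minus the sum of the geometric series
  a / (1 - a X), with the denominator multiplied out.\<close>

lemma fps_deriv_prod_one_minus:
  fixes as :: "'a::field list"
  defines "P \<equiv> \<lambda>as. \<Prod>a\<leftarrow>as. 1 - fps_const a * fps_X"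
  shows "fps_deriv (P as) = - P as * Abs_fps (\<lambda>i. \<Sum>a\<leftarrow>as. a ^ Suc i)"
proof (induction as)
  case Nil
  then show ?case by (simp add: P_def fps_eq_iff)
next
  case (Cons a as)
  let ?g = "Abs_fps (\<lambda>i. a ^ Suc i)" and ?G = "Abs_fps (\<lambda>i. \<Sum>a\<leftarrow>as. a ^ Suc i)"
  have geo: "(1 - fps_const a * fps_X) * ?g = fps_const a"
  proof (rule fps_ext)
    fix i show "fps_nth ((1 - fps_const a * fps_X) * ?g) i = fps_nth (fps_const a) i"
      by (cases i) (simp_all add: left_diff_distrib mult.assoc)
  qed
  have "fps_deriv (P (a # as)) = - fps_const a * P as + (1 - fps_const a * fps_X) * fps_deriv (P as)"
    by (simp add: P_def)
  also have "\<dots> = - P (a # as) * (?g + ?G)"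
    unfolding Cons by (subst geo[symmetric]) (simp add: P_def algebra_simps)
  also have "?g + ?G = Abs_fps (\<lambda>i. \<Sum>a\<leftarrow>a # as. a ^ Suc i)"
    by (simp add: fps_eq_iff)
  finally show ?case .
qed

text \<open>Coefficient \<open>j\<close> of the derivative formula for the product over the
  eigenvalues. The identity covers every \<open>j\<close>, also beyond \<open>n\<close>, because
  \<open>rev_char_coeff\<close> vanishes there; the number of traces used later is not tied to
  \<open>n\<close>.\<close>

lemma newton_identity:
  "of_nat (Suc j) * rev_char_coeff n x (Suc j) =
     - (\<Sum>i\<le>j. trace_pow n x (Suc i) * rev_char_coeff n x (j - i))"
proof -
  obtain as where det: "\<And>z. det (1\<^sub>m n - z \<cdot>\<^sub>m mat n n x) = (\<Prod>a\<leftarrow>as. 1 - z * a)"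
    and tr: "\<And>k. trace_pow n x k = (\<Sum>a\<leftarrow>as. a ^ k)"
    using eigenvalue_list[of "mat n n x" n] unfolding trace_pow_def by auto
  define p where "p = (\<Prod>a\<leftarrow>as. [:1, - a:])"
  define q where "q = (\<Sum>k\<le>n. monom (rev_char_coeff n x k) k)"
  have "poly p z = poly q z" for z
  proof -
    have "poly p z = (\<Prod>a\<leftarrow>as. 1 - z * a)"
      unfolding p_def by (induction as) (simp_all add: algebra_simps)
    also have "\<dots> = poly q z"
      using det[of z] by (simp add: q_def poly_sum poly_monom det_one_minus_smult)
    finally show ?thesis .
  qed
  then have "p = q" by (intro poly_eqI_degree poly_ext) 
  moreover have "coeff q k = rev_char_coeff n x k" for k
    by (cases "k \<le> n") (auto simp: q_def coeff_sum rev_char_coeff_eq_0)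
  ultimately have c: "rev_char_coeff n x k = fps_nth (fps_of_poly p) k" for k by simp
  have P: "fps_of_poly p = (\<Prod>a\<leftarrow>as. 1 - fps_const a * fps_X)"
    unfolding p_def by (induction as) (simp_all add: fps_of_poly_mult fps_of_poly_pCons del: mult_pCons_left)
  have "of_nat (Suc j) * fps_nth (fps_of_poly p) (Suc j) = fps_nth (fps_deriv (fps_of_poly p)) j"
    by simp
  also have "\<dots> = - fps_nth (Abs_fps (\<lambda>i. \<Sum>a\<leftarrow>as. a ^ Suc i) * fps_of_poly p) j"
    unfolding P fps_deriv_prod_one_minus by (simp add: mult.commute)
  also have "\<dots> = - (\<Sum>i\<le>j. trace_pow n x (Suc i) * rev_char_coeff n x (j - i))"
    by (simp add: fps_mult_nth tr c atLeast0AtMost)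
  finally show ?thesis by (simp only: c)
qed

section \<open>Traces of powers as sums over closed walks\<close>

lemma mat_pow_walks:
  assumes "i < n" "j < n"
  shows "(mat n n x ^\<^sub>m k) $$ (i, j) =
    (\<Sum>f\<in>{f \<in> {..k} \<rightarrow>\<^sub>E {..<n}. f 0 = i \<and> f k = j}. \<Prod>t<k. x (f t, f (Suc t)))"
  using assms(2)
proof (induction k arbitrary: j)
  case 0
  let ?g = "\<lambda>t\<in>{..0::nat}. i"
  have uniq: "f = ?g" if "f \<in> {..0} \<rightarrow>\<^sub>E {..<n}" "f 0 = i" for f :: "nat \<Rightarrow> nat"
  proof
    fix t show "f t = ?g t"
      using that(2) PiE_arb[OF that(1), of t] by (cases t) (simp_all only: restrict_apply atMost_iff le0 if_True, simp)
  qed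
  have mem: "?g \<in> {..0} \<rightarrow>\<^sub>E {..<n}" "?g 0 = i"
    using assms(1) by (simp_all add: PiE_iff)
  show ?case
  proof (cases "i = j")
    case True
    have start: "{f \<in> {..0} \<rightarrow>\<^sub>E {..<n}. f 0 = i \<and> f 0 = j} = {?g}"
      using uniq mem True by blast
    show ?thesis unfolding start using True 0 by simp
  next
    case False
    then have start: "{f \<in> {..0} \<rightarrow>\<^sub>E {..<n}. f 0 = i \<and> f 0 = j} = {}" by blast
    show ?thesis unfolding start using False 0 assms(1) by simp
  qed
next
  case (Suc k)
  let ?X = "mat n n x"
  have "(?X ^\<^sub>m Suc k) $$ (i, j) = (\<Sum>l<n. (?X ^\<^sub>m k) $$ (i, l) * x (l, j))"
    using assms Suc.prems by (simp add: scalar_prod_def lessThan_atLeast0 pow_carrier_mat[of ?X n])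
  also have "\<dots> = (\<Sum>l<n. \<Sum>f\<in>{f \<in> {f\<in>{..k} \<rightarrow>\<^sub>E {..<n}. f 0 = i}. f k = l}. (\<Prod>t<k. x (f t, f (Suc t))) * x (f k, j))"
    using Suc.IH by (auto simp: sum_distrib_right intro!: sum.cong)
  also have "\<dots> = (\<Sum>f\<in>{f\<in>{..k} \<rightarrow>\<^sub>E {..<n}. f 0 = i}. (\<Prod>t<k. x (f t, f (Suc t))) * x (f k, j))"
    by (rule sum.group) (auto intro!: finite_subset[OF _ finite_PiE[of "{..k}" "\<lambda>_. {..<n}"]])
  also have "\<dots> = (\<Sum>f\<in>{f \<in> {..Suc k} \<rightarrow>\<^sub>E {..<n}. f 0 = i \<and> f (Suc k) = j}. \<Prod>t<Suc k. x (f t, f (Suc t)))"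
    by (rule sum.reindex_bij_witness[where i = "\<lambda>f. restrict f {..k}" and j = "\<lambda>f. f(Suc k := j)"])
       (use Suc.prems in \<open>auto simp: PiE_iff extensional_def fun_eq_iff intro!: prod.cong\<close>)
  finally show ?case .
qed

text \<open>The last vertex of a closed walk repeats the first, so it is dropped and the successor
  of a time is taken modulo \<open>k\<close>. Length 0 is excluded: there the trace is
  \<open>n\<close>, but the sum on the right is 1.\<close>

lemma trace_pow_closed_walks:
  assumes "k > 0"
  shows "trace_pow n x k = (\<Sum>f\<in>{..<k} \<rightarrow>\<^sub>E {..<n}. \<Prod>t<k. x (f t, f (Suc t mod k)))"
proof -
  have "trace_pow n x k = (\<Sum>i<n. \<Sum>f\<in>{f \<in> {f \<in> {..k} \<rightarrow>\<^sub>E {..<n}. f 0 = f k}. f 0 = i}. \<Prod>t<k. x (f t, f (Suc t)))"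
    unfolding trace_pow_def by (intro sum.cong refl) (auto simp: mat_pow_walks intro!: sum.cong)
  also have "\<dots> = (\<Sum>f\<in>{f \<in> {..k} \<rightarrow>\<^sub>E {..<n}. f 0 = f k}. \<Prod>t<k. x (f t, f (Suc t)))"
    by (rule sum.group) (auto intro!: finite_subset[OF _ finite_PiE[of "{..k}" "\<lambda>_. {..<n}"]])
  also have "\<dots> = (\<Sum>f\<in>{..<k} \<rightarrow>\<^sub>E {..<n}. \<Prod>t<k. x (f t, f (Suc t mod k)))"
  proof (rule sum.reindex_bij_witness[where i = "\<lambda>f. f(k := f 0)" and j = "\<lambda>f. restrict f {..<k}"])
    fix f assume f: "f \<in> {f \<in> {..k} \<rightarrow>\<^sub>E {..<n}. f 0 = f k}"
    have "restrict f {..<k} (Suc t mod k) = f (Suc t)" if "t < k" for t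
      using f that assms by (cases "Suc t = k") auto
    then show "(\<Prod>t<k. x (restrict f {..<k} t, restrict f {..<k} (Suc t mod k))) = (\<Prod>t<k. x (f t, f (Suc t)))"
      by (intro prod.cong) auto
  qed (use assms in \<open>auto simp: PiE_iff extensional_def fun_eq_iff\<close>)
  finally show ?thesis .
qed

section \<open>Counting closed walks\<close>

text \<open>The coincidence pattern of a labelling. Labellings with the same kernel differ by an
  injective renaming of vertices, and the number of kernels on a finite \<open>T\<close> is bounded
  independently of the number of available vertices.\<close>

definition kernel_on :: "'a set \<Rightarrow> ('a \<Rightarrow> 'b) \<Rightarrow> ('a \<times> 'a) set" where
  "kernel_on T h = {(t, u). t \<in> T \<and> u \<in> T \<and> h t = h u}"

text \<open>A labelling with a given kernel of s classes is determined by its values on s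
  representatives. So there are at most n^s of them, each of weight n^(-s), and every kernel
  contributes at most 1.\<close>

lemma sum_kernel_le_card:
  assumes T: "finite T" and R: "finite \<R>" and n: "n > 0"
  shows "(\<Sum>h\<in>{h \<in> T \<rightarrow>\<^sub>E {..<n}. kernel_on T h \<in> \<R>}. 1 / real n ^ card (h ` T)) \<le> card \<R>"
proof -
  let ?F = "\<lambda>R. {h \<in> T \<rightarrow>\<^sub>E {..<n}. kernel_on T h = R}"
  have fin: "finite (T \<rightarrow>\<^sub>E {..<n})" using T by (intro finite_PiE) auto
  have "(\<Sum>h\<in>?F R. 1 / real n ^ card (h ` T)) \<le> 1" for R
  proof (cases "?F R = {}")
    case False
    then obtain h0 where h0: "h0 \<in> ?F R" by blast
    have ker: "h t = h u \<longleftrightarrow> (t, u) \<in> R" if "h \<in> ?F R" "t \<in> T" "u \<in> T" for h t u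
      using that unfolding kernel_on_def by blast
    \<comment> \<open>\<open>S\<close> contains one time from each class of the kernel. It is found
      from one labelling \<open>h0\<close> and serves all labellings with that kernel.\<close>
    obtain S where S: "S \<subseteq> T" "inj_on h0 S" "h0 ` T = h0 ` S"
      using subset_image_inj[of "h0 ` T" h0 T] by auto
    have rep: "\<exists>s\<in>S. (t, s) \<in> R" if "t \<in> T" for t
    proof -
      from that S obtain s where "s \<in> S" "h0 t = h0 s" by blast
      with ker[OF h0] that S(1) show ?thesis by blast
    qed
    have card: "card (h ` T) = card S" if "h \<in> ?F R" for h
    proof -
      have "h ` T = h ` S"
      proof (rule antisym; rule subsetI)
        fix y assume "y \<in> h ` T"
        then obtain t where t: "t \<in> T" "y = h t" by blast
        then obtain s where "s \<in> S" "(t, s) \<in> R" using rep by blast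
        with t ker[OF that] S(1) show "y \<in> h ` S" by blast
      qed (use S(1) in blast)
      moreover have "inj_on h S"
      proof (rule inj_onI)
        fix s s' assume s: "s \<in> S" "s' \<in> S" "h s = h s'"
        then have "h0 s = h0 s'" using ker[OF that] ker[OF h0] S(1) by blast
        with s S(2) show "s = s'" by (simp add: inj_onD)
      qed
      ultimately show ?thesis by (simp add: card_image)
    qed
    have "inj_on (\<lambda>h. restrict h S) (?F R)"
    proof (rule inj_onI)
      fix h g assume h: "h \<in> ?F R" and g: "g \<in> ?F R" and eq: "restrict h S = restrict g S"
      have "h t = g t" if t: "t \<in> T" for t
      proof -
        obtain s where s: "s \<in> S" "(t, s) \<in> R" using rep[OF t] by blast
        then have "h t = h s" "g t = g s" using ker[OF h] ker[OF g] t S(1) by blast+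
        moreover have "h s = g s" using eq s(1) by (metis restrict_apply')
        ultimately show ?thesis by simp
      qed
      moreover have "h \<in> T \<rightarrow>\<^sub>E {..<n}" "g \<in> T \<rightarrow>\<^sub>E {..<n}" using h g by blast+
      ultimately show "h = g" by (blast intro: PiE_ext)
    qed
    then have "card (?F R) \<le> card (S \<rightarrow>\<^sub>E {..<n})"
      using S(1) T by (intro card_inj_on_le) (auto intro!: finite_PiE intro: finite_subset)
    also have "\<dots> = n ^ card S"
      using S(1) T by (subst card_PiE) (auto intro: finite_subset)
    finally have le: "card (?F R) \<le> n ^ card S" .
    have "(\<Sum>h\<in>?F R. 1 / real n ^ card (h ` T)) = (\<Sum>h\<in>?F R. 1 / real n ^ card S)"
      using card by (intro sum.cong) auto
    also have "\<dots> = real (card (?F R)) / real n ^ card S" by simp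
    also have "\<dots> \<le> 1"
      using n of_nat_mono[OF le, where 'a = real] by (intro divide_le_eq_1_pos[THEN iffD2]) simp_all
    finally show ?thesis .
  qed (simp only: sum.empty zero_le_one)
  then have "(\<Sum>R\<in>\<R>. \<Sum>h\<in>?F R. 1 / real n ^ card (h ` T)) \<le> (\<Sum>R\<in>\<R>. 1)"
    by (intro sum_mono)
  moreover have "(\<Sum>h\<in>{h \<in> T \<rightarrow>\<^sub>E {..<n}. kernel_on T h \<in> \<R>}. 1 / real n ^ card (h ` T)) =
      (\<Sum>R\<in>\<R>. \<Sum>h\<in>{h \<in> {h \<in> T \<rightarrow>\<^sub>E {..<n}. kernel_on T h \<in> \<R>}. kernel_on T h = R}. 1 / real n ^ card (h ` T))"
    using R fin by (intro sum.group[symmetric]) auto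
  moreover have "{h \<in> {h \<in> T \<rightarrow>\<^sub>E {..<n}. kernel_on T h \<in> \<R>}. kernel_on T h = R} = ?F R" if "R \<in> \<R>" for R
    using that by auto
  ultimately show ?thesis by simp
qed

text \<open>The first projection maps the distinct edges onto the visited vertices. The two numbers
  agree only if this projection is injective, which means that every vertex has a single
  successor.\<close>

lemma card_edges_functional:
  assumes "finite T" "\<And>t. t \<in> T \<Longrightarrow> s t \<in> T"
  shows "card (h ` T) \<le> card ((\<lambda>t. (h t, h (s t))) ` T)"
    and "\<not> (\<forall>t\<in>T. \<forall>u\<in>T. h t = h u \<longrightarrow> h (s t) = h (s u)) \<Longrightarrow>
      Suc (card (h ` T)) \<le> card ((\<lambda>t. (h t, h (s t))) ` T)"
proof -
  let ?E = "(\<lambda>t. (h t, h (s t))) ` T"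
  have fst: "fst ` ?E = h ` T" by (auto simp: image_image)
  have fin: "finite ?E" using assms by simp
  show le: "card (h ` T) \<le> card ?E"
    using card_image_le[OF fin, of fst] fst by simp
  assume nf: "\<not> (\<forall>t\<in>T. \<forall>u\<in>T. h t = h u \<longrightarrow> h (s t) = h (s u))"
  have "card (h ` T) \<noteq> card ?E"
  proof
    assume "card (h ` T) = card ?E"
    then have "inj_on fst ?E" using fin fst by (intro eq_card_imp_inj_on) simp_all
    then have inj: "inj_on fst ?E" .
    have "h (s t) = h (s u)" if "t \<in> T" "u \<in> T" "h t = h u" for t u
    proof -
      have "(h t, h (s t)) \<in> ?E" "(h u, h (s u)) \<in> ?E" using that by blast+
      from inj_onD[OF inj _ this] that show ?thesis by simp
    qed
    with nf show False by blast
  qed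
  with le show "Suc (card (h ` T)) \<le> card ?E" by simp
qed

text \<open>Coincidences propagate forwards by \<open>step\<close>. They also propagate backwards:
  after a coincidence at shift \<open>j\<close>, another \<open>j * (k - 1)\<close> steps make the
  total shift \<open>j * k\<close>, a whole number of periods.\<close>

lemma periodic_cancel:
  fixes H :: "'b \<Rightarrow> nat \<Rightarrow> 'v"
  assumes k: "k > 0" and per: "\<And>b t. H b (t + k) = H b t"
    and step: "\<And>b c t u. H b t = H c u \<Longrightarrow> H b (Suc t) = H c (Suc u)"
  shows periodic_mult: "H b (t + q * k) = H b t"
    and periodic_shift_iff: "H b (t + j) = H c (u + j) \<longleftrightarrow> H b t = H c u"
proof -
  have mult: "H b (t + q * k) = H b t" for b t q
    using per by (induction q) (simp_all add: add.assoc[symmetric] add.commute[of k])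
  have shift: "H b (t + j) = H c (u + j)" if "H b t = H c u" for b c t u j
  proof (induction j)
    case 0
    then show ?case using that by simp
  next
    case (Suc j)
    then show ?case using step[of b "t + j" c "u + j"] by simp
  qed
  show "H b (t + q * k) = H b t" by (rule mult)
  show "H b (t + j) = H c (u + j) \<longleftrightarrow> H b t = H c u"
  proof
    assume "H b (t + j) = H c (u + j)"
    from shift[OF this, of "j * (k - 1)"] have "H b (t + j * k) = H c (u + j * k)"
      using k by (cases k) (simp_all add: algebra_simps)
    then show "H b t = H c u" by (simp add: mult)
  qed (rule shift)
qed

text \<open>Since steps can be cancelled, the walk runs round one cycle without repetitions. Its
  length \<open>d\<close> is the first return time to the start, and \<open>d \<le> k\<close>
  because \<open>k\<close> is a return time.\<close>

lemma periodic_kernel: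
  fixes G :: "nat \<Rightarrow> 'v"
  assumes k: "k > 0" and per: "\<And>t. G (t + k) = G t"
    and step: "\<And>t u. G t = G u \<Longrightarrow> G (Suc t) = G (Suc u)"
  shows "\<exists>d\<in>{1..k}. \<forall>t u. G t = G u \<longleftrightarrow> [t = u] (mod d)"
proof -
  define d where "d = (LEAST d. d > 0 \<and> G d = G 0)"
  have "k > 0 \<and> G k = G 0" using k per[of 0] by simp
  then have d: "d > 0" "G d = G 0" and dk: "d \<le> k"
    unfolding d_def by (metis (mono_tags, lifting) LeastI, metis (mono_tags, lifting) LeastI, metis (mono_tags, lifting) Least_le)
  have least: "d \<le> e" if "e > 0" "G e = G 0" for e
    unfolding d_def using that by (intro Least_le) simp
  have shift: "G (t + j) = G (u + j) \<longleftrightarrow> G t = G u" for t u j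
    using periodic_shift_iff[of k "\<lambda>_::unit. G" "()" t j "()" u] k per step by blast
  have perd: "G (t + d) = G t" for t
    using shift[of d t 0] d by (simp add: add.commute)
  have multd: "G (t + q * d) = G t" for t q
    using perd by (induction q) (simp_all add: add.assoc[symmetric] add.commute[of d])
  have zero: "G w = G 0 \<longleftrightarrow> d dvd w" for w
  proof -
    have "G w = G (w mod d)" using multd[of "w mod d" "w div d"] by simp
    moreover have "w mod d < d" using d by simp
    ultimately show ?thesis using least[of "w mod d"] by (metis dvd_eq_mod_eq_0 linorder_not_le neq0_conv)
  qed
  have le: "G t = G u \<longleftrightarrow> [t = u] (mod d)" if "t \<le> u" for t u
    using shift[of 0 t "u - t"] that zero[of "u - t"]
    by (metis add_0 le_add_diff_inverse2 cong_altdef_nat cong_sym_eq)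
  have "G t = G u \<longleftrightarrow> [t = u] (mod d)" for t u
    using le[of t u] le[of u t] by (metis cong_sym_eq nle_le)
  then show ?thesis using d dk by (intro bexI[of _ d]) auto
qed

text \<open>With deterministic successors each of the two walks runs round a cycle, and two walks
  that meet once stay together from then on. The pattern is therefore fixed by two periods, with
  \<open>k\<close> choices each, and one offset, with \<open>k\<close> choices or the value for
  disjoint cycles.\<close>

lemma card_functional_kernels:
  fixes k :: nat
  defines "T \<equiv> (UNIV :: bool set) \<times> {..<k}"
  defines "s \<equiv> \<lambda>(b :: bool, t). (b, Suc t mod k)"
  assumes k: "k > 0"
  shows "card {kernel_on T h |h :: bool \<times> nat \<Rightarrow> 'v. \<forall>t\<in>T. \<forall>u\<in>T. h t = h u \<longrightarrow> h (s t) = h (s u)} \<le> k * k * Suc k"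
proof -
  \<comment> \<open>\<open>d b\<close> is the minimal period of the walk \<open>b\<close>, and \<open>m\<close> is the time at which the walk \<open>False\<close> passes
    through the starting point of the walk \<open>True\<close>, with \<open>m = k\<close> if it never does.\<close>
  define \<Psi> where "\<Psi> = (\<lambda>(d :: bool \<Rightarrow> nat, m). {((b, t), (c, u)). t < k \<and> u < k \<and>
    (if b = c then [t = u] (mod d b) else m < k \<and>
      (if b then [u = m + t] (mod d False) else [t = m + u] (mod d False)))})"
  let ?C = "((UNIV :: bool set) \<rightarrow>\<^sub>E {1..k}) \<times> {..k}"
  have "{kernel_on T h |h :: bool \<times> nat \<Rightarrow> 'v. \<forall>t\<in>T. \<forall>u\<in>T. h t = h u \<longrightarrow> h (s t) = h (s u)} \<subseteq> \<Psi> ` ?C" (is "?K \<subseteq> _")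
  proof clarify
    fix h :: "bool \<times> nat \<Rightarrow> 'v"
    assume func: "\<forall>t\<in>T. \<forall>u\<in>T. h t = h u \<longrightarrow> h (s t) = h (s u)"
    define H where "H = (\<lambda>b t. h (b, t mod k))"
    have per: "H b (t + k) = H b t" for b t by (simp add: H_def)
    have step: "H b (Suc t) = H c (Suc u)" if "H b t = H c u" for b c t u
      using func[rule_format, of "(b, t mod k)" "(c, u mod k)"] that k
      by (simp add: H_def T_def s_def mod_Suc_eq)
    note mult = periodic_mult[of k H, OF k per step] and shift = periodic_shift_iff[of k H, OF k per step]
    have "\<exists>d\<in>{1..k}. \<forall>t u. H b t = H b u \<longleftrightarrow> [t = u] (mod d)" for b
      by (rule periodic_kernel[OF k per step])
    then obtain d where d: "\<And>b. d b \<in> {1..k}" "\<And>b t u. H b t = H b u \<longleftrightarrow> [t = u] (mod d b)"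
      by (metis (no_types))
    obtain m where m: "m \<le> k" "\<And>t u. H False t = H True u \<longleftrightarrow> m < k \<and> [t = m + u] (mod d False)"
    proof (cases "\<exists>m<k. H False m = H True 0")
      case True
      then obtain m where m: "m < k" "H False m = H True 0" by blast
      have "H False (m + u) = H True u" for u using shift[of False m u True 0] m by simp
      then have "H False t = H True u \<longleftrightarrow> m < k \<and> [t = m + u] (mod d False)" for t u
        using d(2)[of False t "m + u"] m by simp
      with m show ?thesis by (intro that[of m]) auto
    next
      case False
      have "H False t \<noteq> H True u" for t u
      proof
        assume "H False t = H True u"
        \<comment> \<open>Both walks advance by the same number of steps, chosen so that the second
          reaches time \<open>u * k\<close> and is back at its start. The first walk then passes
          through that start, which was excluded.\<close>
        then have "H False (t + u * (k - 1)) = H True (u + u * (k - 1))" using shift by blast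
        also have "u + u * (k - 1) = 0 + u * k" using k by (cases k) simp_all
        also have "H True (0 + u * k) = H True 0" by (rule mult)
        finally have "H False ((t + u * (k - 1)) mod k) = H True 0" by (simp add: H_def)
        moreover have "(t + u * (k - 1)) mod k < k" using k by simp
        ultimately show False using False by blast
      qed
      then show ?thesis by (intro that[of k]) auto
    qed
    have hH: "h (b, t) = H b t" if "t < k" for b t using that by (simp add: H_def)
    have "((b, t), (c, u)) \<in> kernel_on T h \<longleftrightarrow> ((b, t), (c, u)) \<in> \<Psi> (d, m)" for b t c u
    proof (cases "t < k \<and> u < k")
      case True
      then have "((b, t), (c, u)) \<in> kernel_on T h \<longleftrightarrow> H b t = H c u"
        by (simp add: kernel_on_def T_def hH)
      also have "\<dots> \<longleftrightarrow> ((b, t), (c, u)) \<in> \<Psi> (d, m)"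
        using True d(2)[of b t u] m(2)[of t u] m(2)[of u t]
        by (cases b; cases c) (auto simp: \<Psi>_def)
      finally show ?thesis .
    qed (auto simp: kernel_on_def T_def \<Psi>_def)
    then have "kernel_on T h = \<Psi> (d, m)" by auto
    moreover have "(d, m) \<in> ?C" using d m by (auto simp: PiE_iff)
    ultimately show "kernel_on T h \<in> \<Psi> ` ?C" by blast
  qed
  moreover have fin: "finite ?C"
    by (intro finite_cartesian_product finite_PiE finite_class.finite_UNIV finite_atLeastAtMost finite_atMost)
  ultimately have "card ?K \<le> card (\<Psi> ` ?C)"
    by (intro card_mono finite_imageI)
  also have "\<dots> \<le> card ?C"
    using fin by (rule card_image_le)
  also have "\<dots> = k * k * Suc k"
    by (simp add: card_cartesian_product card_PiE UNIV_bool)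
  finally show ?thesis .
qed

text \<open>The two values of the boolean distinguish the walk from T_k and the walk from its
  conjugate; the weight carries one factor 1/n per distinct edge. In pairs with deterministic
  successors the weight at most balances the number of labellings, so each kernel costs at most 1.
  All other pairs have an edge to spare, hence a further 1/n, and for them the crude count
  2^((2k)^2) of all relations on \<open>T\<close> is good enough.\<close>

lemma sum_closed_walk_pairs_le:
  fixes k n :: nat
  defines "T \<equiv> (UNIV :: bool set) \<times> {..<k}"
  defines "s \<equiv> \<lambda>(b :: bool, t). (b, Suc t mod k)"
  assumes k: "k > 0" and n: "n > 0"
  shows "(\<Sum>h\<in>T \<rightarrow>\<^sub>E {..<n}. 1 / real n ^ card ((\<lambda>t. (h t, h (s t))) ` T)) \<le>
    k * k * Suc k + 2 ^ (2 * k * (2 * k)) / n"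
proof -
  let ?E = "\<lambda>h. (\<lambda>t. (h t, h (s t))) ` T"
  define func where "func h \<longleftrightarrow> (\<forall>t\<in>T. \<forall>u\<in>T. h t = h u \<longrightarrow> h (s t) = h (s u))" for h :: "bool \<times> nat \<Rightarrow> nat"
  define \<R> where "\<R> = {kernel_on T h |h. func h}"
  have T: "finite T" and cardT: "card T = 2 * k" by (simp_all add: T_def card_cartesian_product)
  have s: "s t \<in> T" if "t \<in> T" for t using k that by (auto simp: s_def T_def)
  have kerT: "kernel_on T h \<in> Pow (T \<times> T)" for h :: "bool \<times> nat \<Rightarrow> nat" by (auto simp: kernel_on_def)
  have finR: "finite \<R>"
    using kerT T by (intro finite_subset[of \<R> "Pow (T \<times> T)"]) (auto simp: \<R>_def)
  have fin: "finite (T \<rightarrow>\<^sub>E {..<n})" using T by (intro finite_PiE) auto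
  have "(\<Sum>h\<in>T \<rightarrow>\<^sub>E {..<n}. 1 / real n ^ card (?E h)) =
      (\<Sum>h\<in>{h\<in>T \<rightarrow>\<^sub>E {..<n}. func h}. 1 / real n ^ card (?E h)) +
      (\<Sum>h\<in>{h\<in>T \<rightarrow>\<^sub>E {..<n}. \<not> func h}. 1 / real n ^ card (?E h))"
    using fin by (subst sum.union_disjoint[symmetric]) (auto intro!: sum.cong)
  also have "(\<Sum>h\<in>{h\<in>T \<rightarrow>\<^sub>E {..<n}. func h}. 1 / real n ^ card (?E h)) \<le>
      (\<Sum>h\<in>{h\<in>T \<rightarrow>\<^sub>E {..<n}. kernel_on T h \<in> \<R>}. 1 / real n ^ card (h ` T))"
  proof (rule order.trans[OF sum_mono sum_mono2])
    fix h
    show "1 / real n ^ card (?E h) \<le> 1 / real n ^ card (h ` T)"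
      using n card_edges_functional(1)[of T s h] T s
      by (intro divide_left_mono power_increasing mult_pos_pos) auto
  qed (use fin in \<open>auto simp: \<R>_def\<close>)
  also have "\<dots> \<le> card \<R>"
    by (rule sum_kernel_le_card[OF T finR n])
  also have "real (card \<R>) \<le> real (k * k * Suc k)"
    using card_functional_kernels[OF k, where 'v = nat] unfolding \<R>_def func_def T_def s_def of_nat_le_iff .
  also have "(\<Sum>h\<in>{h\<in>T \<rightarrow>\<^sub>E {..<n}. \<not> func h}. 1 / real n ^ card (?E h)) \<le>
      (\<Sum>h\<in>{h\<in>T \<rightarrow>\<^sub>E {..<n}. kernel_on T h \<in> Pow (T \<times> T)}. 1 / real n ^ card (h ` T) / n)"
  proof (rule order.trans[OF sum_mono sum_mono2])
    fix h assume "h \<in> {h\<in>T \<rightarrow>\<^sub>E {..<n}. \<not> func h}"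
    then have "1 / real n ^ card (?E h) \<le> 1 / real n ^ Suc (card (h ` T))"
      using n card_edges_functional(2)[of T s h] T s
      by (intro divide_left_mono power_increasing mult_pos_pos) (auto simp: func_def)
    then show "1 / real n ^ card (?E h) \<le> 1 / real n ^ card (h ` T) / n"
      by (simp add: mult.commute)
  qed (use fin kerT in auto)
  also have "\<dots> = (\<Sum>h\<in>{h\<in>T \<rightarrow>\<^sub>E {..<n}. kernel_on T h \<in> Pow (T \<times> T)}. 1 / real n ^ card (h ` T)) / n"
    by (simp add: sum_divide_distrib)
  also have "\<dots> \<le> card (Pow (T \<times> T)) / n"
    by (intro divide_right_mono sum_kernel_le_card) (use T n in auto)
  also have "real (card (Pow (T \<times> T))) = 2 ^ (2 * k * (2 * k))"
    using T cardT by (simp add: card_Pow card_cartesian_product)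
  finally show ?thesis by simp
qed

section \<open>Second moments\<close>

text \<open>The weights are made for an induction: they turn a bound k^2 for \<open>a\<close> and 1
  for \<open>b\<close> into (1 + 1/k) k^2 + (1 + k) = (k + 1)^2. With weights 2 and 2 the induction
  would lose a factor exponential in the number of steps.\<close>

lemma cmod_add_squared_le:
  fixes a b :: complex and k :: nat
  assumes "k > 0"
  shows "(cmod (a + b))\<^sup>2 \<le> (1 + 1 / k) * (cmod a)\<^sup>2 + (1 + k) * (cmod b)\<^sup>2"
proof -
  have "(cmod (a + b))\<^sup>2 \<le> (cmod a + cmod b)\<^sup>2"
    by (intro power_mono norm_triangle_ineq) simp
  also have "0 \<le> (cmod a - k * cmod b)\<^sup>2 / k" by simp
  then have "(cmod a + cmod b)\<^sup>2 \<le> (cmod a + cmod b)\<^sup>2 + (cmod a - k * cmod b)\<^sup>2 / k" by simp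
  also have "\<dots> = (1 + 1 / k) * (cmod a)\<^sup>2 + (1 + k) * (cmod b)\<^sup>2"
    using assms by (simp add: power2_eq_square field_simps)
  finally show ?thesis .
qed

lemma borel_measurable_cnj [measurable (raw)]:
  assumes "f \<in> borel_measurable M"
  shows "(\<lambda>\<omega>. cnj (f \<omega>)) \<in> borel_measurable M"
  using assms borel_measurable_continuous_onI[of cnj] 
  by (intro measurable_compose[of f M borel cnj]) (auto intro: continuous_intros)

lemma (in prob_space) expectation_le_of_square:
  fixes X :: "'a \<Rightarrow> complex"
  assumes X: "X \<in> borel_measurable M" "integrable M (\<lambda>\<omega>. (cmod (X \<omega>))\<^sup>2)"
    and c: "expectation (\<lambda>\<omega>. (cmod (X \<omega>))\<^sup>2) \<le> c\<^sup>2" "c \<ge> 0"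
  shows "integrable M (\<lambda>\<omega>. cmod (X \<omega>))" "expectation (\<lambda>\<omega>. cmod (X \<omega>)) \<le> c"
proof -
  show int: "integrable M (\<lambda>\<omega>. cmod (X \<omega>))"
    by (rule square_integrable_imp_integrable[OF _ X(2)]) (use X(1) in measurable)
  have "0 \<le> variance (\<lambda>\<omega>. cmod (X \<omega>))" by (rule variance_positive)
  also have "\<dots> = expectation (\<lambda>\<omega>. (cmod (X \<omega>))\<^sup>2) - (expectation (\<lambda>\<omega>. cmod (X \<omega>)))\<^sup>2"
    using int X by (intro variance_eq) auto
  finally have "(expectation (\<lambda>\<omega>. cmod (X \<omega>)))\<^sup>2 \<le> c\<^sup>2" using c(1) by linarith
  then show "expectation (\<lambda>\<omega>. cmod (X \<omega>)) \<le> c" using c(2) by (rule power2_le_imp_le)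
qed

lemma (in prob_space) expectation_orthogonal_sum:
  fixes D :: "'i \<Rightarrow> 'a \<Rightarrow> complex" and c :: "'i \<Rightarrow> complex"
  assumes I: "finite I"
    and int: "\<And>i j. i \<in> I \<Longrightarrow> j \<in> I \<Longrightarrow> integrable M (\<lambda>\<omega>. D i \<omega> * cnj (D j \<omega>))"
    and orth: "\<And>i j. i \<in> I \<Longrightarrow> j \<in> I \<Longrightarrow> i \<noteq> j \<Longrightarrow> expectation (\<lambda>\<omega>. D i \<omega> * cnj (D j \<omega>)) = 0"
  shows "integrable M (\<lambda>\<omega>. (cmod (\<Sum>i\<in>I. c i * D i \<omega>))\<^sup>2)"
    and "expectation (\<lambda>\<omega>. (cmod (\<Sum>i\<in>I. c i * D i \<omega>))\<^sup>2) =
      (\<Sum>i\<in>I. (cmod (c i))\<^sup>2 * expectation (\<lambda>\<omega>. (cmod (D i \<omega>))\<^sup>2))"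
proof -
  let ?F = "\<lambda>\<omega>. \<Sum>i\<in>I. \<Sum>j\<in>I. c i * cnj (c j) * (D i \<omega> * cnj (D j \<omega>))"
  have eq: "complex_of_real ((cmod (\<Sum>i\<in>I. c i * D i \<omega>))\<^sup>2) = ?F \<omega>" for \<omega>
    by (subst complex_norm_square) (simp add: cnj_sum sum_product mult_ac)
  have intF: "integrable M ?F" using int by auto
  then have "integrable M (\<lambda>\<omega>. Re (?F \<omega>))" by (rule integrable_Re)
  moreover have "Re (?F \<omega>) = (cmod (\<Sum>i\<in>I. c i * D i \<omega>))\<^sup>2" for \<omega>
    unfolding eq[symmetric] by (rule Re_complex_of_real)
  ultimately show "integrable M (\<lambda>\<omega>. (cmod (\<Sum>i\<in>I. c i * D i \<omega>))\<^sup>2)" by simp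
  have diag: "expectation (\<lambda>\<omega>. D i \<omega> * cnj (D i \<omega>)) = complex_of_real (expectation (\<lambda>\<omega>. (cmod (D i \<omega>))\<^sup>2))" for i
    by (simp add: complex_norm_square[symmetric] del: of_real_power)
  have "complex_of_real (expectation (\<lambda>\<omega>. (cmod (\<Sum>i\<in>I. c i * D i \<omega>))\<^sup>2)) = expectation ?F"
    unfolding eq[symmetric] by (rule integral_complex_of_real[symmetric])
  also have "\<dots> = (\<Sum>i\<in>I. \<Sum>j\<in>I. c i * cnj (c j) * expectation (\<lambda>\<omega>. D i \<omega> * cnj (D j \<omega>)))"
    using int by (simp add: Bochner_Integration.integral_sum)
  also have "\<dots> = (\<Sum>i\<in>I. \<Sum>j\<in>I. if j = i then c i * cnj (c i) * expectation (\<lambda>\<omega>. D i \<omega> * cnj (D i \<omega>)) else 0)"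
    using orth by (intro sum.cong refl) auto
  also have "\<dots> = (\<Sum>i\<in>I. c i * cnj (c i) * expectation (\<lambda>\<omega>. D i \<omega> * cnj (D i \<omega>)))"
    using I by simp
  also have "\<dots> = complex_of_real (\<Sum>i\<in>I. (cmod (c i))\<^sup>2 * expectation (\<lambda>\<omega>. (cmod (D i \<omega>))\<^sup>2))"
    unfolding diag by (simp add: complex_norm_square[symmetric] of_real_sum)
  finally show "expectation (\<lambda>\<omega>. (cmod (\<Sum>i\<in>I. c i * D i \<omega>))\<^sup>2) =
      (\<Sum>i\<in>I. (cmod (c i))\<^sup>2 * expectation (\<lambda>\<omega>. (cmod (D i \<omega>))\<^sup>2))"
    unfolding of_real_eq_iff .
qed

text \<open>\<open>x\<close> holds the entries of X, and \<open>\<phi>\<close>, the truncation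
  followed by recentring, is the same function for every entry. The scale 1/n of the second moments
  is where sparsity and normalisation meet; \<open>\<tau>\<close> is the Lindeberg quantity. The
  bound \<open>cmod (\<phi> z) \<le> 1\<close> reduces all higher moments of the truncated entries
  to the second.\<close>

locale truncated_array = prob_space M for M :: "'a measure" +
  fixes n :: nat and x :: "nat \<times> nat \<Rightarrow> 'a \<Rightarrow> complex" and \<phi> :: "complex \<Rightarrow> complex" and \<tau> :: real
  assumes n_pos: "n > 0" and tau_nonneg: "\<tau> \<ge> 0"
    and indep: "indep_vars (\<lambda>_. borel) x (entries n)"
    and phi_measurable: "\<phi> \<in> borel_measurable borel"
    and phi_bounded: "cmod (\<phi> z) \<le> 1"
    and square_integrable: "p \<in> entries n \<Longrightarrow> integrable M (\<lambda>\<omega>. (cmod (x p \<omega>))\<^sup>2)"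
    and mean: "p \<in> entries n \<Longrightarrow> expectation (x p) = 0"
    and second_moment: "p \<in> entries n \<Longrightarrow> expectation (\<lambda>\<omega>. (cmod (x p \<omega>))\<^sup>2) \<le> 1 / n"
    and phi_mean: "p \<in> entries n \<Longrightarrow> expectation (\<lambda>\<omega>. \<phi> (x p \<omega>)) = 0"
    and phi_second_moment: "p \<in> entries n \<Longrightarrow> expectation (\<lambda>\<omega>. (cmod (\<phi> (x p \<omega>)))\<^sup>2) \<le> 1 / n"
    and phi_error: "p \<in> entries n \<Longrightarrow> expectation (\<lambda>\<omega>. (cmod (x p \<omega> - \<phi> (x p \<omega>)))\<^sup>2) \<le> \<tau> / n"
begin

lemma finite_entries: "finite (entries n)"
  by (simp add: entries_def)

lemma x_measurable: "p \<in> entries n \<Longrightarrow> x p \<in> borel_measurable M"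
  using indep by (auto simp: indep_vars_def)

lemma comp_measurable:
  "u \<in> borel_measurable borel \<Longrightarrow> p \<in> entries n \<Longrightarrow> (\<lambda>\<omega>. u (x p \<omega>)) \<in> borel_measurable M"
  using x_measurable measurable_compose by blast

lemma expectation_prod:
  fixes h :: "nat \<times> nat \<Rightarrow> complex \<Rightarrow> 'b :: {real_normed_field, banach, second_countable_topology}"
  assumes S: "S \<subseteq> entries n" and h: "\<And>p. p \<in> S \<Longrightarrow> h p \<in> borel_measurable borel"
    and int: "\<And>p. p \<in> S \<Longrightarrow> integrable M (\<lambda>\<omega>. h p (x p \<omega>))"
  shows "expectation (\<lambda>\<omega>. \<Prod>p\<in>S. h p (x p \<omega>)) = (\<Prod>p\<in>S. expectation (\<lambda>\<omega>. h p (x p \<omega>)))"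
    and "integrable M (\<lambda>\<omega>. \<Prod>p\<in>S. h p (x p \<omega>))"
proof -
  have fin: "finite S" using S finite_entries by (rule finite_subset)
  have "indep_vars (\<lambda>_. borel) (\<lambda>p \<omega>. h p (x p \<omega>)) S"
    using indep_vars_compose2[OF indep_vars_subset[OF indep S], of h "\<lambda>_. borel"] h by simp
  from indep_vars_lebesgue_integral[OF fin this int] indep_vars_integrable[OF fin this int]
  show "expectation (\<lambda>\<omega>. \<Prod>p\<in>S. h p (x p \<omega>)) = (\<Prod>p\<in>S. expectation (\<lambda>\<omega>. h p (x p \<omega>)))"
    and "integrable M (\<lambda>\<omega>. \<Prod>p\<in>S. h p (x p \<omega>))" by simp_all
qed

text \<open>Square-integrability is the right requirement, since in a product of a square-free
  monomial with a conjugate one every entry occurs at most once on each side. The identity,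
  \<open>\<phi>\<close> and their difference all qualify.\<close>

definition admissible :: "(complex \<Rightarrow> complex) \<Rightarrow> bool" where
  "admissible u \<longleftrightarrow> u \<in> borel_measurable borel \<and>
    (\<forall>p\<in>entries n. integrable M (\<lambda>\<omega>. (cmod (u (x p \<omega>)))\<^sup>2))"

lemma admissible_measurable: "admissible u \<Longrightarrow> p \<in> entries n \<Longrightarrow> (\<lambda>\<omega>. u (x p \<omega>)) \<in> borel_measurable M"
  unfolding admissible_def using comp_measurable by blast

lemma admissible_integrable_mult:
  assumes "admissible u" "admissible v" "p \<in> entries n"
  shows "integrable M (\<lambda>\<omega>. u (x p \<omega>) * cnj (v (x p \<omega>)))"
proof (rule Bochner_Integration.integrable_bound)
  show "integrable M (\<lambda>\<omega>. (cmod (u (x p \<omega>)))\<^sup>2 + (cmod (v (x p \<omega>)))\<^sup>2)"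
    using assms by (auto simp: admissible_def)
  show "(\<lambda>\<omega>. u (x p \<omega>) * cnj (v (x p \<omega>))) \<in> borel_measurable M"
    using assms by (intro borel_measurable_times borel_measurable_cnj admissible_measurable)
  have "a * b \<le> a\<^sup>2 + b\<^sup>2" if "a \<ge> 0" "b \<ge> 0" for a b :: real
    using sum_squares_bound[of a b] that mult_nonneg_nonneg[OF that] by linarith
  then show "AE \<omega> in M. norm (u (x p \<omega>) * cnj (v (x p \<omega>)))
      \<le> norm ((cmod (u (x p \<omega>)))\<^sup>2 + (cmod (v (x p \<omega>)))\<^sup>2)"
    by (simp add: norm_mult)
qed

lemma admissible_integrable:
  assumes "admissible u" "p \<in> entries n"
  shows "integrable M (\<lambda>\<omega>. u (x p \<omega>))"
proof -
  have "integrable M (\<lambda>\<omega>. cmod (u (x p \<omega>)))"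
    using assms admissible_measurable[OF assms]
    by (intro square_integrable_imp_integrable[of "\<lambda>\<omega>. cmod (u (x p \<omega>))"]) (auto simp: admissible_def)
  then show ?thesis
    using admissible_measurable[OF assms] by (rule integrable_norm_cancel)
qed

lemma admissible_id: "admissible (\<lambda>z. z)"
  using square_integrable by (simp add: admissible_def)

lemma admissible_phi: "admissible \<phi>"
  unfolding admissible_def
proof (intro conjI ballI phi_measurable)
  fix p assume "p \<in> entries n"
  then show "integrable M (\<lambda>\<omega>. (cmod (\<phi> (x p \<omega>)))\<^sup>2)"
    using phi_bounded comp_measurable[OF phi_measurable]
    by (intro integrable_const_bound[where B = 1]) (auto simp: power_le_one)
qed

lemma admissible_diff:
  assumes "admissible u" "admissible v"
  shows "admissible (\<lambda>z. u z - v z)"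
  unfolding admissible_def
proof (intro conjI ballI)
  show "(\<lambda>z. u z - v z) \<in> borel_measurable borel"
    using assms by (auto simp: admissible_def)
  fix p assume p: "p \<in> entries n"
  show "integrable M (\<lambda>\<omega>. (cmod (u (x p \<omega>) - v (x p \<omega>)))\<^sup>2)"
  proof (rule Bochner_Integration.integrable_bound)
    show "integrable M (\<lambda>\<omega>. 2 * (cmod (u (x p \<omega>)))\<^sup>2 + 2 * (cmod (v (x p \<omega>)))\<^sup>2)"
      using assms p by (auto simp: admissible_def)
    show "(\<lambda>\<omega>. (cmod (u (x p \<omega>) - v (x p \<omega>)))\<^sup>2) \<in> borel_measurable M"
      using admissible_measurable[OF assms(1) p] admissible_measurable[OF assms(2) p] by measurable
    show "AE \<omega> in M. norm ((cmod (u (x p \<omega>) - v (x p \<omega>)))\<^sup>2)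
        \<le> norm (2 * (cmod (u (x p \<omega>)))\<^sup>2 + 2 * (cmod (v (x p \<omega>)))\<^sup>2)"
      using cmod_add_squared_le[of 1] by (intro AE_I2) (simp, metis add_uminus_conv_diff norm_minus_cancel)
  qed
qed

section \<open>Square-free monomials and their truncation errors\<close>

definition monom_of :: "(complex \<Rightarrow> complex) \<Rightarrow> (nat \<times> nat) set \<Rightarrow> 'a \<Rightarrow> complex" where
  "monom_of u S \<omega> = (\<Prod>p\<in>S. u (x p \<omega>))"

lemma monom_of_measurable:
  "admissible u \<Longrightarrow> S \<subseteq> entries n \<Longrightarrow> monom_of u S \<in> borel_measurable M"
  unfolding monom_of_def using admissible_measurable by (intro borel_measurable_prod) auto

text \<open>An entry that lies in only one of \<open>S\<close> and \<open>T\<close> contributes a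
  single centred factor, and by independence this factor annihilates the expectation. Two different
  functions are allowed because the monomial differences below mix the identity with
  \<open>\<phi>\<close>.\<close>

lemma monom_of_inner:
  assumes u: "admissible u" and v: "admissible v" and S: "S \<subseteq> entries n" and T: "T \<subseteq> entries n"
  shows "integrable M (\<lambda>\<omega>. monom_of u S \<omega> * cnj (monom_of v T \<omega>))"
    and "\<lbrakk>\<And>p. p \<in> entries n \<Longrightarrow> expectation (\<lambda>\<omega>. u (x p \<omega>)) = 0;
          \<And>p. p \<in> entries n \<Longrightarrow> expectation (\<lambda>\<omega>. v (x p \<omega>)) = 0; S \<noteq> T\<rbrakk> \<Longrightarrow>
      expectation (\<lambda>\<omega>. monom_of u S \<omega> * cnj (monom_of v T \<omega>)) = 0"
proof -
  \<comment> \<open>\<open>h p\<close> collects everything that depends on entry \<open>p\<close>,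
    so that the mixed product becomes one product of independent factors over the union.\<close>
  define h where "h p z = (if p \<in> S then u z else 1) * (if p \<in> T then cnj (v z) else 1)" for p z
  have fin: "finite (S \<union> T)" using S T finite_entries by (meson finite_UnI finite_subset)
  have eq: "monom_of u S \<omega> * cnj (monom_of v T \<omega>) = (\<Prod>p\<in>S \<union> T. h p (x p \<omega>))" for \<omega>
  proof -
    have "(\<Prod>p\<in>S. u (x p \<omega>)) = (\<Prod>p\<in>S \<union> T. if p \<in> S then u (x p \<omega>) else 1)"
      using fin by (intro prod.mono_neutral_cong_left) auto
    moreover have "(\<Prod>p\<in>T. cnj (v (x p \<omega>))) = (\<Prod>p\<in>S \<union> T. if p \<in> T then cnj (v (x p \<omega>)) else 1)"
      using fin by (intro prod.mono_neutral_cong_left) auto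
    ultimately show ?thesis by (simp add: monom_of_def h_def prod.distrib)
  qed
  have ST: "S \<union> T \<subseteq> entries n" using S T by blast
  have meas: "h p \<in> borel_measurable borel" for p
    using u v unfolding h_def admissible_def by (cases "p \<in> S"; cases "p \<in> T") auto
  have int: "integrable M (\<lambda>\<omega>. h p (x p \<omega>))" if "p \<in> S \<union> T" for p
    using that ST admissible_integrable_mult[OF u v, of p] admissible_integrable[OF u, of p]
      admissible_integrable[OF v, of p]
    unfolding h_def by (cases "p \<in> S"; cases "p \<in> T") auto
  note prod = expectation_prod[OF ST meas int]
  show "integrable M (\<lambda>\<omega>. monom_of u S \<omega> * cnj (monom_of v T \<omega>))"
    unfolding eq by (rule prod(2))
  assume zu: "\<And>p. p \<in> entries n \<Longrightarrow> expectation (\<lambda>\<omega>. u (x p \<omega>)) = 0"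
    and zv: "\<And>p. p \<in> entries n \<Longrightarrow> expectation (\<lambda>\<omega>. v (x p \<omega>)) = 0" and "S \<noteq> T"
  then obtain p where p: "p \<in> S \<union> T" "p \<notin> S \<or> p \<notin> T" by blast
  then have "expectation (\<lambda>\<omega>. h p (x p \<omega>)) = 0"
    using zu[of p] zv[of p] ST unfolding h_def by (cases "p \<in> S") auto
  then have "(\<Prod>p\<in>S \<union> T. expectation (\<lambda>\<omega>. h p (x p \<omega>))) = 0"
    using fin p(1) by (intro prod_zero) auto
  then show "expectation (\<lambda>\<omega>. monom_of u S \<omega> * cnj (monom_of v T \<omega>)) = 0"
    unfolding eq using prod(1) by (rule trans[rotated])
qed

lemma expectation_prod_squares:
  assumes S: "S \<subseteq> entries n" and g: "\<And>p. p \<in> S \<Longrightarrow> admissible (g p)"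
  shows "integrable M (\<lambda>\<omega>. \<Prod>p\<in>S. (cmod (g p (x p \<omega>)))\<^sup>2)"
    and "expectation (\<lambda>\<omega>. \<Prod>p\<in>S. (cmod (g p (x p \<omega>)))\<^sup>2) =
      (\<Prod>p\<in>S. expectation (\<lambda>\<omega>. (cmod (g p (x p \<omega>)))\<^sup>2))"
proof -
  have "(\<lambda>z. (cmod (g p z))\<^sup>2) \<in> borel_measurable borel" if "p \<in> S" for p
    using g[OF that] by (auto simp: admissible_def)
  moreover have "integrable M (\<lambda>\<omega>. (cmod (g p (x p \<omega>)))\<^sup>2)" if "p \<in> S" for p
    using g[OF that] S that by (auto simp: admissible_def)
  ultimately show "integrable M (\<lambda>\<omega>. \<Prod>p\<in>S. (cmod (g p (x p \<omega>)))\<^sup>2)"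
    and "expectation (\<lambda>\<omega>. \<Prod>p\<in>S. (cmod (g p (x p \<omega>)))\<^sup>2) =
      (\<Prod>p\<in>S. expectation (\<lambda>\<omega>. (cmod (g p (x p \<omega>)))\<^sup>2))"
    using expectation_prod[OF S, of "\<lambda>p z. (cmod (g p z))\<^sup>2"] by blast+
qed

lemma expectation_monom_square_le:
  assumes S: "S \<subseteq> entries n" and u: "admissible u"
    and le: "\<And>p. p \<in> S \<Longrightarrow> expectation (\<lambda>\<omega>. (cmod (u (x p \<omega>)))\<^sup>2) \<le> 1 / n"
  shows "integrable M (\<lambda>\<omega>. (cmod (monom_of u S \<omega>))\<^sup>2)"
    and "expectation (\<lambda>\<omega>. (cmod (monom_of u S \<omega>))\<^sup>2) \<le> (1 / n) ^ card S"
proof -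
  have eq: "(cmod (monom_of u S \<omega>))\<^sup>2 = (\<Prod>p\<in>S. (cmod (u (x p \<omega>)))\<^sup>2)" for \<omega>
    by (simp add: monom_of_def prod_norm[symmetric] prod_power_distrib)
  show "integrable M (\<lambda>\<omega>. (cmod (monom_of u S \<omega>))\<^sup>2)"
    unfolding eq by (rule expectation_prod_squares(1)[OF S u])
  have "expectation (\<lambda>\<omega>. (cmod (monom_of u S \<omega>))\<^sup>2) =
      (\<Prod>p\<in>S. expectation (\<lambda>\<omega>. (cmod (u (x p \<omega>)))\<^sup>2))"
    unfolding eq by (rule expectation_prod_squares(2)[OF S u])
  also have "\<dots> \<le> (\<Prod>p\<in>S. 1 / n)"
    using le by (intro prod_mono) auto
  finally show "expectation (\<lambda>\<omega>. (cmod (monom_of u S \<omega>))\<^sup>2) \<le> (1 / n) ^ card S"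
    by simp
qed

definition monom_diff :: "(nat \<times> nat) set \<Rightarrow> 'a \<Rightarrow> complex" where
  "monom_diff S \<omega> = monom_of (\<lambda>z. z) S \<omega> - monom_of \<phi> S \<omega>"

text \<open>The additional factor over \<open>R\<close> makes the induction on \<open>S\<close> go through without a
  separate independence argument for the non-multiplicative \<open>monom_diff S\<close>.\<close>

lemma expectation_monom_diff_aux:
  assumes "finite S" "S \<subseteq> entries n" "R \<subseteq> entries n" "S \<inter> R = {}"
    and "\<And>p. p \<in> R \<Longrightarrow> admissible (g p)"
  shows "integrable M (\<lambda>\<omega>. (\<Prod>p\<in>R. (cmod (g p (x p \<omega>)))\<^sup>2) * (cmod (monom_diff S \<omega>))\<^sup>2)"
    and "expectation (\<lambda>\<omega>. (\<Prod>p\<in>R. (cmod (g p (x p \<omega>)))\<^sup>2) * (cmod (monom_diff S \<omega>))\<^sup>2) \<le>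
      (\<Prod>p\<in>R. expectation (\<lambda>\<omega>. (cmod (g p (x p \<omega>)))\<^sup>2)) * ((card S)\<^sup>2 * \<tau> * (1 / n) ^ card S)"
proof -
  let ?G = "\<lambda>R g \<omega>. \<Prod>p\<in>R. (cmod (g p (x p \<omega>)))\<^sup>2"
  let ?E = "\<lambda>R g. \<Prod>p\<in>R. expectation (\<lambda>\<omega>. (cmod (g p (x p \<omega>)))\<^sup>2)"
  have "integrable M (\<lambda>\<omega>. ?G R g \<omega> * (cmod (monom_diff S \<omega>))\<^sup>2) \<and>
    expectation (\<lambda>\<omega>. ?G R g \<omega> * (cmod (monom_diff S \<omega>))\<^sup>2) \<le> ?E R g * ((card S)\<^sup>2 * \<tau> * (1 / n) ^ card S)"
    using assms
  proof (induction S arbitrary: R g rule: finite_induct)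
    case empty
    then show ?case by (simp add: monom_diff_def monom_of_def)
  next
    case (insert q S)
    define k where "k = card S"
    have q: "q \<in> entries n" "q \<notin> S" "q \<notin> R" and S: "S \<subseteq> entries n" "finite S" and R: "R \<subseteq> entries n" "S \<inter> R = {}"
      using insert by auto
    have finR: "finite R" using R(1) finite_entries by (rule finite_subset)
    note g = insert.prems(4)
    have E0: "?E R g \<ge> 0" by (intro prod_nonneg) simp
    define d where "d z = z - \<phi> z" for z
    have adm_d: "admissible d"
      unfolding d_def by (intro admissible_diff admissible_id admissible_phi)
    \<comment> \<open>Telescoping: the difference either stays in the other factors, multiplied by
      \<open>x q\<close>, or it is made at \<open>q\<close> and all other factors are
      truncated.\<close>
    have split: "monom_diff (insert q S) \<omega> = x q \<omega> * monom_diff S \<omega> + d (x q \<omega>) * monom_of \<phi> S \<omega>" for \<omega>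
      using q S by (simp add: monom_diff_def monom_of_def d_def algebra_simps)
    let ?A = "\<lambda>\<omega>. ?G R g \<omega> * ((cmod (x q \<omega>))\<^sup>2 * (cmod (monom_diff S \<omega>))\<^sup>2)"
    let ?B = "\<lambda>\<omega>. ?G R g \<omega> * ((cmod (d (x q \<omega>)))\<^sup>2 * (cmod (monom_of \<phi> S \<omega>))\<^sup>2)"
    \<comment> \<open>The factor at \<open>q\<close> moves into the auxiliary product, so that the
      induction hypothesis applies with \<open>insert q R\<close>.\<close>
    define gA where "gA = g(q := \<lambda>z. z)"
    have A: "?A \<omega> = ?G (insert q R) gA \<omega> * (cmod (monom_diff S \<omega>))\<^sup>2" for \<omega>
    proof -
      have "?G R gA \<omega> = ?G R g \<omega>" using q(3) by (intro prod.cong) (auto simp: gA_def)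
      then show ?thesis using q(3) finR by (simp add: gA_def mult_ac)
    qed
    have EA: "?E (insert q R) gA \<le> ?E R g * (1 / n)"
    proof -
      have "?E R gA = ?E R g" using q(3) by (intro prod.cong) (auto simp: gA_def)
      then have "?E (insert q R) gA = ?E R g * expectation (\<lambda>\<omega>. (cmod (x q \<omega>))\<^sup>2)"
        using q(3) finR by (simp add: gA_def mult.commute)
      then show ?thesis using second_moment[OF q(1)] E0 by (simp add: mult_left_mono del: times_divide_eq_right)
    qed
    have "insert q R \<subseteq> entries n" "S \<inter> insert q R = {}" using q R by auto
    moreover have "admissible (gA p)" if "p \<in> insert q R" for p
      using that g[of p] admissible_id unfolding gA_def by (cases "p = q") simp_all
    ultimately have IH: "integrable M ?A"
      "expectation ?A \<le> ?E (insert q R) gA * (k\<^sup>2 * \<tau> * (1 / n) ^ k)"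
      using insert.IH[of "insert q R" gA] S unfolding A k_def by blast+
    note IH(2)
    also have "?E (insert q R) gA * (k\<^sup>2 * \<tau> * (1 / n) ^ k) \<le> (?E R g * (1 / n)) * (k\<^sup>2 * \<tau> * (1 / n) ^ k)"
      using EA tau_nonneg by (intro mult_right_mono) auto
    also have "\<dots> = ?E R g * (k\<^sup>2 * \<tau> * (1 / n) ^ Suc k)" by simp
    finally have leA: "expectation ?A \<le> ?E R g * (k\<^sup>2 * \<tau> * (1 / n) ^ Suc k)" .
    \<comment> \<open>In the second summand everything is a product over single entries: the
      truncation error at \<open>q\<close>, \<open>\<phi>\<close> on \<open>S\<close>, and the given
      functions on \<open>R\<close>.\<close>
    define gB where "gB p = (if p = q then d else if p \<in> S then \<phi> else g p)" for p
    let ?U = "insert q (S \<union> R)"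
    have gB_R: "gB p = g p" if "p \<in> R" for p using that q R by (auto simp: gB_def)
    have gB_S: "gB p = \<phi>" if "p \<in> S" for p using that q by (auto simp: gB_def)
    have prodU: "(\<Prod>p\<in>?U. f p) = f q * ((\<Prod>p\<in>S. f p) * (\<Prod>p\<in>R. f p))" for f :: "nat \<times> nat \<Rightarrow> real"
      using q S R finR by (simp add: prod.union_disjoint)
    have B: "?B \<omega> = ?G ?U gB \<omega>" for \<omega>
    proof -
      have "?G S gB \<omega> = (cmod (monom_of \<phi> S \<omega>))\<^sup>2"
        by (simp add: gB_S monom_of_def prod_norm[symmetric] prod_power_distrib)
      moreover have "?G R gB \<omega> = ?G R g \<omega>" by (simp add: gB_R)
      ultimately show ?thesis unfolding prodU by (simp add: gB_def mult_ac)
    qed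
    have U: "?U \<subseteq> entries n" using q S R by auto
    have admB: "admissible (gB p)" if "p \<in> ?U" for p
      using that g[of p] adm_d admissible_phi unfolding gB_def by (cases "p = q"; cases "p \<in> S") simp_all
    have intB: "integrable M ?B"
      unfolding B by (rule expectation_prod_squares(1)[OF U admB])
    have "expectation ?B = ?E ?U gB"
      unfolding B by (rule expectation_prod_squares(2)[OF U admB])
    also have "\<dots> = expectation (\<lambda>\<omega>. (cmod (d (x q \<omega>)))\<^sup>2) * (?E S (\<lambda>_. \<phi>) * ?E R g)"
      unfolding prodU by (simp add: gB_S gB_R) (simp add: gB_def)
    also have "\<dots> \<le> (\<tau> / n) * ((1 / n) ^ k * ?E R g)"
    proof (intro mult_mono)
      have "?E S (\<lambda>_. \<phi>) \<le> (\<Prod>p\<in>S. 1 / n)"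
        using phi_second_moment S by (intro prod_mono) auto
      then show "?E S (\<lambda>_. \<phi>) \<le> (1 / n) ^ k" by (simp add: k_def)
    qed (use phi_error[OF q(1)] E0 tau_nonneg in \<open>auto simp: d_def intro!: mult_nonneg_nonneg prod_nonneg\<close>)
    also have "\<dots> = ?E R g * (\<tau> * (1 / n) ^ Suc k)" by (simp add: field_simps)
    finally have leB: "expectation ?B \<le> ?E R g * (\<tau> * (1 / n) ^ Suc k)" .
    have card: "card (insert q S) = Suc k" using q S by (simp add: k_def)
    \<comment> \<open>For \<open>k = 0\<close> the first summand is a difference of empty products,
      hence 0, and may carry weight 0. For \<open>k > 0\<close> the weights come from
      \<open>cmod_add_squared_le\<close>, and they turn k^2 into (k + 1)^2.\<close>
    let ?c = "if k = 0 then 0 else 1 + 1 / k"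
    have bound: "?G R g \<omega> * (cmod (monom_diff (insert q S) \<omega>))\<^sup>2 \<le> ?c * ?A \<omega> + (1 + k) * ?B \<omega>" for \<omega>
    proof -
      have "(cmod (monom_diff (insert q S) \<omega>))\<^sup>2 \<le>
        ?c * (cmod (x q \<omega> * monom_diff S \<omega>))\<^sup>2 + (1 + k) * (cmod (d (x q \<omega>) * monom_of \<phi> S \<omega>))\<^sup>2"
      proof (cases "k = 0")
        case True
        then have "S = {}" using S by (simp add: k_def)
        then show ?thesis using True unfolding split by (simp add: monom_diff_def monom_of_def)
      next
        case False
        then show ?thesis using cmod_add_squared_le[of k] unfolding split by simp
      qed
      moreover have "?G R g \<omega> \<ge> 0" by (intro prod_nonneg) simp
      ultimately have "?G R g \<omega> * (cmod (monom_diff (insert q S) \<omega>))\<^sup>2 \<le> ?G R g \<omega> *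
        (?c * (cmod (x q \<omega> * monom_diff S \<omega>))\<^sup>2 + (1 + k) * (cmod (d (x q \<omega>) * monom_of \<phi> S \<omega>))\<^sup>2)"
        by (rule mult_left_mono)
      also have "\<dots> = ?c * ?A \<omega> + (1 + k) * ?B \<omega>"
        unfolding norm_mult power_mult_distrib by (simp only: ring_distribs mult_ac)
      finally show ?thesis .
    qed
    have int: "integrable M (\<lambda>\<omega>. ?c * ?A \<omega> + (1 + k) * ?B \<omega>)"
      using IH(1) intB by (intro Bochner_Integration.integrable_add integrable_mult_right)
    have gmeas: "(\<lambda>\<omega>. g p (x p \<omega>)) \<in> borel_measurable M" if "p \<in> R" for p
      using admissible_measurable[OF g[OF that]] that R by blast
    have dmeas: "monom_diff (insert q S) \<in> borel_measurable M"
      unfolding monom_diff_def using q S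
      by (intro borel_measurable_diff monom_of_measurable admissible_id admissible_phi) auto
    have meas: "(\<lambda>\<omega>. ?G R g \<omega> * (cmod (monom_diff (insert q S) \<omega>))\<^sup>2) \<in> borel_measurable M"
      using gmeas dmeas by (intro borel_measurable_times borel_measurable_prod borel_measurable_power borel_measurable_norm) auto
    have nonneg: "0 \<le> ?G R g \<omega> * (cmod (monom_diff (insert q S) \<omega>))\<^sup>2" for \<omega>
      by (intro mult_nonneg_nonneg prod_nonneg) auto
    have int': "integrable M (\<lambda>\<omega>. ?G R g \<omega> * (cmod (monom_diff (insert q S) \<omega>))\<^sup>2)"
    proof (rule Bochner_Integration.integrable_bound[OF int meas], rule AE_I2)
      fix \<omega>
      show "norm (?G R g \<omega> * (cmod (monom_diff (insert q S) \<omega>))\<^sup>2) \<le> norm (?c * ?A \<omega> + (1 + k) * ?B \<omega>)"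
        using bound[of \<omega>] nonneg[of \<omega>] unfolding real_norm_def by linarith
    qed
    have "expectation (\<lambda>\<omega>. ?G R g \<omega> * (cmod (monom_diff (insert q S) \<omega>))\<^sup>2) \<le>
        expectation (\<lambda>\<omega>. ?c * ?A \<omega> + (1 + k) * ?B \<omega>)"
      by (rule integral_mono[OF int' int bound])
    also have "\<dots> = ?c * expectation ?A + (1 + k) * expectation ?B"
      using IH(1) intB by (subst Bochner_Integration.integral_add) (simp_all only: integrable_mult_right integral_mult_right_zero)
    also have "\<dots> \<le> ?c * (?E R g * (k\<^sup>2 * \<tau> * (1 / n) ^ Suc k)) + (1 + k) * (?E R g * (\<tau> * (1 / n) ^ Suc k))"
      using leA leB by (intro add_mono mult_left_mono) auto
    also have "\<dots> = (?c * k\<^sup>2 + (1 + k)) * (?E R g * (\<tau> * (1 / n) ^ Suc k))"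
      by (simp only: ring_distribs mult_ac)
    also have "?c * k\<^sup>2 + (1 + k) = (Suc k)\<^sup>2"
      by (cases "k = 0") (simp_all add: power2_eq_square field_simps)
    also have "real ((Suc k)\<^sup>2) * (?E R g * (\<tau> * (1 / n) ^ Suc k)) = ?E R g * ((Suc k)\<^sup>2 * \<tau> * (1 / n) ^ Suc k)"
      by (simp only: mult_ac)
    finally show ?case unfolding card using int' by blast
  qed
  then show "integrable M (\<lambda>\<omega>. ?G R g \<omega> * (cmod (monom_diff S \<omega>))\<^sup>2)"
    and "expectation (\<lambda>\<omega>. ?G R g \<omega> * (cmod (monom_diff S \<omega>))\<^sup>2) \<le> ?E R g * ((card S)\<^sup>2 * \<tau> * (1 / n) ^ card S)"
    by blast+
qed

lemma expectation_monom_diff_square_le: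
  assumes S: "S \<subseteq> entries n"
  shows "expectation (\<lambda>\<omega>. (cmod (monom_diff S \<omega>))\<^sup>2) \<le> (card S)\<^sup>2 * \<tau> * (1 / n) ^ card S"
  using expectation_monom_diff_aux(2)[of S "{}"] S finite_subset[OF S finite_entries] by simp

end

section \<open>Coefficients as sums over graphs of partial permutations\<close>

definition perm_graph :: "nat set \<times> (nat \<Rightarrow> nat) \<Rightarrow> (nat \<times> nat) set" where
  "perm_graph = (\<lambda>(I, p). (\<lambda>i. (i, p i)) ` I)"

lemma perm_graph_subset: "d \<in> partial_perms n k \<Longrightarrow> perm_graph d \<subseteq> entries n"
proof -
  assume d: "d \<in> partial_perms n k"
  obtain I p where Ip: "d = (I, p)" by (cases d)
  then have I: "I \<subseteq> {0..<n}" and p: "p permutes I" using d by (auto simp: partial_perms_def)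
  have "i < n \<and> p i < n" if "i \<in> I" for i
    using that I permutes_in_image[OF p, of i] by auto
  then show ?thesis by (auto simp: Ip perm_graph_def entries_def)
qed

lemma card_perm_graph: "d \<in> partial_perms n k \<Longrightarrow> card (perm_graph d) = k"
  unfolding partial_perms_def perm_graph_def
  by (auto simp: card_image inj_on_def)

text \<open>The graph determines \<open>I\<close> as its first projection, and \<open>p\<close> is
  the identity off \<open>I\<close>. Thus different terms of a coefficient are different square-free
  monomials, which is what makes them orthogonal.\<close>

lemma inj_on_perm_graph: "inj_on perm_graph (partial_perms n k)"
proof (rule inj_onI)
  fix c d assume c: "c \<in> partial_perms n k" and d: "d \<in> partial_perms n k" and eq: "perm_graph c = perm_graph d"
  obtain I p where cI: "c = (I, p)" by (cases c)
  obtain J q where dJ: "d = (J, q)" by (cases d)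
  have pq: "p permutes I" "q permutes J" using c d cI dJ by (auto simp: partial_perms_def)
  have "fst ` perm_graph c = I" "fst ` perm_graph d = J"
    by (simp_all add: perm_graph_def cI dJ image_image)
  with eq have IJ: "I = J" by simp
  have "p i = q i" for i
  proof (cases "i \<in> I")
    case True
    then have "(i, p i) \<in> perm_graph d" using eq cI by (auto simp: perm_graph_def)
    then show ?thesis using dJ by (auto simp: perm_graph_def)
  next
    case False
    then show ?thesis using pq IJ by (simp add: permutes_not_in)
  qed
  then show "c = d" using cI dJ IJ by (simp add: fun_eq_iff)
qed

definition perm_sign :: "nat \<Rightarrow> nat set \<times> (nat \<Rightarrow> nat) \<Rightarrow> complex" where
  "perm_sign k d = (-1) ^ k * signof (snd d)"

lemma cmod_perm_sign: "cmod (perm_sign k d) = 1"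
  by (auto simp: perm_sign_def norm_mult norm_power sign_def)

lemma rev_char_coeff_eq_graph_sum:
  "rev_char_coeff n x k = (\<Sum>d\<in>partial_perms n k. perm_sign k d * (\<Prod>p\<in>perm_graph d. x p))"
  unfolding rev_char_coeff_def
proof (intro sum.cong refl)
  fix d assume "d \<in> partial_perms n k"
  obtain I p where d: "d = (I, p)" by (cases d)
  have "(\<Prod>q\<in>perm_graph d. x q) = (\<Prod>i\<in>I. x (i, p i))"
    unfolding d perm_graph_def by (simp add: prod.reindex inj_on_def)
  then show "(case d of (I, p) \<Rightarrow> (-1) ^ k * signof p * (\<Prod>i\<in>I. x (i, p i))) =
      perm_sign k d * (\<Prod>p\<in>perm_graph d. x p)"
    by (simp add: d perm_sign_def)
qed

text \<open>A pair of closed walks is merged into one labelling of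
  \<open>UNIV \<times> {..<k}\<close>, with \<open>True\<close> marking the conjugated walk. All 2k
  steps then enter the expectation and the counting on an equal footing, and edges shared by the two
  walks need no special treatment.\<close>

lemma cmod_closed_walk_sum_squared:
  fixes y :: "nat \<times> nat \<Rightarrow> complex"
  shows "(\<Sum>f\<in>{..<k} \<rightarrow>\<^sub>E {..<n}. \<Prod>t<k. y (f t, f (Suc t mod k))) *
      cnj (\<Sum>f\<in>{..<k} \<rightarrow>\<^sub>E {..<n}. \<Prod>t<k. y (f t, f (Suc t mod k))) =
    (\<Sum>h\<in>(UNIV :: bool set) \<times> {..<k} \<rightarrow>\<^sub>E {..<n}.
      \<Prod>(b, t)\<in>UNIV \<times> {..<k}. (if b then cnj else id) (y (h (b, t), h (b, Suc t mod k))))"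
proof (cases "k = 0")
  case False
  let ?P = "{..<k} \<rightarrow>\<^sub>E {..<n}" and ?T = "(UNIV :: bool set) \<times> {..<k}"
  let ?F = "\<lambda>f. \<Prod>t<k. y (f t, f (Suc t mod k))"
  have "(\<Sum>f\<in>?P. ?F f) * cnj (\<Sum>f\<in>?P. ?F f) = (\<Sum>(f, g)\<in>?P \<times> ?P. ?F f * cnj (?F g))"
    by (simp add: cnj_sum sum_product sum.cartesian_product)
  also have "\<dots> = (\<Sum>h\<in>?T \<rightarrow>\<^sub>E {..<n}.
      \<Prod>(b, t)\<in>?T. (if b then cnj else id) (y (h (b, t), h (b, Suc t mod k))))"
  proof (rule sum.reindex_bij_witness[where
        i = "\<lambda>h. (\<lambda>t\<in>{..<k}. h (False, t), \<lambda>t\<in>{..<k}. h (True, t))" and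
        j = "\<lambda>(f, g). \<lambda>(b, t)\<in>?T. if b then g t else f t"])
    fix a assume a: "a \<in> ?P \<times> ?P"
    obtain f g where fg: "a = (f, g)" by (cases a)
    let ?h = "\<lambda>(b, t)\<in>?T. if b then g t else f t"
    have mod: "Suc t mod k < k" for t using False by simp
    have h: "?h (False, t) = f t" "?h (True, t) = g t" if "t < k" for t
      using that by simp_all
    have "?T = (\<lambda>t. (False, t)) ` {..<k} \<union> (\<lambda>t. (True, t)) ` {..<k}"
      by (auto simp: UNIV_bool)
    then have "(\<Prod>(b, t)\<in>?T. (if b then cnj else id) (y (?h (b, t), ?h (b, Suc t mod k)))) =
      (\<Prod>t<k. y (?h (False, t), ?h (False, Suc t mod k))) * (\<Prod>t<k. cnj (y (?h (True, t), ?h (True, Suc t mod k))))"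
      by (simp only:) (subst prod.union_disjoint, auto simp: prod.reindex inj_on_def)
    also have "\<dots> = ?F f * cnj (?F g)"
      by (simp add: h mod cnj_prod)
    finally show "(\<Prod>(b, t)\<in>?T. (if b then cnj else id) (y ((case a of (f, g) \<Rightarrow> \<lambda>(b, t)\<in>?T. if b then g t else f t) (b, t),
        (case a of (f, g) \<Rightarrow> \<lambda>(b, t)\<in>?T. if b then g t else f t) (b, Suc t mod k)))) = (case a of (f, g) \<Rightarrow> ?F f * cnj (?F g))"
      by (simp only: fg case_prod_conv)
  next
    fix a assume "a \<in> ?P \<times> ?P"
    then obtain f g where fg: "a = (f, g)" "f \<in> ?P" "g \<in> ?P" by blast
    let ?h = "\<lambda>(b, t)\<in>?T. if b then g t else f t"
    have "(\<lambda>t\<in>{..<k}. ?h (False, t)) t = f t" "(\<lambda>t\<in>{..<k}. ?h (True, t)) t = g t" for t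
      using PiE_arb[OF fg(2), of t] PiE_arb[OF fg(3), of t] by (cases "t < k"; simp)+
    then have "(\<lambda>t\<in>{..<k}. ?h (False, t)) = f" "(\<lambda>t\<in>{..<k}. ?h (True, t)) = g"
      by (intro ext; blast)+
    then show "(\<lambda>t\<in>{..<k}. (case a of (f, g) \<Rightarrow> \<lambda>(b, t)\<in>?T. if b then g t else f t) (False, t),
        \<lambda>t\<in>{..<k}. (case a of (f, g) \<Rightarrow> \<lambda>(b, t)\<in>?T. if b then g t else f t) (True, t)) = a"
      by (simp only: fg case_prod_conv)
    show "(case a of (f, g) \<Rightarrow> \<lambda>(b, t)\<in>?T. if b then g t else f t) \<in> ?T \<rightarrow>\<^sub>E {..<n}"
      using fg by (auto simp: PiE_iff)
  next
    fix h assume h: "h \<in> ?T \<rightarrow>\<^sub>E {..<n}"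
    show "(case (\<lambda>t\<in>{..<k}. h (False, t), \<lambda>t\<in>{..<k}. h (True, t)) of
        (f, g) \<Rightarrow> \<lambda>(b, t)\<in>?T. if b then g t else f t) = h"
    proof
      fix a show "(case (\<lambda>t\<in>{..<k}. h (False, t), \<lambda>t\<in>{..<k}. h (True, t)) of
        (f, g) \<Rightarrow> \<lambda>(b, t)\<in>?T. if b then g t else f t) a = h a"
        using PiE_arb[OF h, of a] by (cases a) auto
    qed
    show "(\<lambda>t\<in>{..<k}. h (False, t), \<lambda>t\<in>{..<k}. h (True, t)) \<in> ?P \<times> ?P"
      using h by (auto simp: PiE_iff)
  qed
  finally show ?thesis .
qed simp

context truncated_array
begin

lemma monom_diff_inner:
  assumes S: "S \<subseteq> entries n" and T: "T \<subseteq> entries n"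
  shows "integrable M (\<lambda>\<omega>. monom_diff S \<omega> * cnj (monom_diff T \<omega>))"
    and "S \<noteq> T \<Longrightarrow> expectation (\<lambda>\<omega>. monom_diff S \<omega> * cnj (monom_diff T \<omega>)) = 0"
proof -
  let ?m = "monom_of (\<lambda>z. z)" and ?m' = "monom_of \<phi>"
  have eq: "monom_diff S \<omega> * cnj (monom_diff T \<omega>) =
      (?m S \<omega> * cnj (?m T \<omega>) - ?m S \<omega> * cnj (?m' T \<omega>)) - (?m' S \<omega> * cnj (?m T \<omega>) - ?m' S \<omega> * cnj (?m' T \<omega>))" for \<omega>
    by (simp add: monom_diff_def algebra_simps)
  note ints = monom_of_inner(1)[OF admissible_id admissible_id S T] monom_of_inner(1)[OF admissible_id admissible_phi S T]
    monom_of_inner(1)[OF admissible_phi admissible_id S T] monom_of_inner(1)[OF admissible_phi admissible_phi S T]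
  show "integrable M (\<lambda>\<omega>. monom_diff S \<omega> * cnj (monom_diff T \<omega>))"
    unfolding eq by (intro Bochner_Integration.integrable_diff ints)
  assume "S \<noteq> T"
  note zero = monom_of_inner(2)[OF admissible_id admissible_id S T mean mean this]
    monom_of_inner(2)[OF admissible_id admissible_phi S T mean phi_mean this]
    monom_of_inner(2)[OF admissible_phi admissible_id S T phi_mean mean this]
    monom_of_inner(2)[OF admissible_phi admissible_phi S T phi_mean phi_mean this]
  show "expectation (\<lambda>\<omega>. monom_diff S \<omega> * cnj (monom_diff T \<omega>)) = 0"
    unfolding eq using ints zero
    by (simp add: Bochner_Integration.integral_diff)
qed

definition coeff :: "nat \<Rightarrow> 'a \<Rightarrow> complex" where
  "coeff k \<omega> = rev_char_coeff n (\<lambda>p. x p \<omega>) k"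

definition coeff' :: "nat \<Rightarrow> 'a \<Rightarrow> complex" where
  "coeff' k \<omega> = rev_char_coeff n (\<lambda>p. \<phi> (x p \<omega>)) k"

text \<open>Only the truncated array gets a trace: a walk may use an edge many times, and high
  moments of the original entries may be infinite.\<close>

definition trace' :: "nat \<Rightarrow> 'a \<Rightarrow> complex" where
  "trace' k \<omega> = trace_pow n (\<lambda>p. \<phi> (x p \<omega>)) k"

lemma sum_partial_perms_le:
  assumes "\<And>d. d \<in> partial_perms n k \<Longrightarrow> f d \<le> c * (1 / n) ^ k" "c \<ge> 0"
  shows "(\<Sum>d\<in>partial_perms n k. f d) \<le> c"
proof -
  have "(\<Sum>d\<in>partial_perms n k. f d) \<le> card (partial_perms n k) * (c * (1 / n) ^ k)"
    using assms(1) by (rule sum_bounded_above)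
  also have "\<dots> \<le> real (n ^ k) * (c * (1 / n) ^ k)"
    using card_partial_perms[of n k] assms(2) by (intro mult_right_mono) (auto simp: of_nat_le_iff simp del: of_nat_power)
  also have "\<dots> = c" using n_pos by (simp add: power_one_over)
  finally show ?thesis .
qed

lemma coeff'_eq: "coeff' k \<omega> = (\<Sum>d\<in>partial_perms n k. perm_sign k d * monom_of \<phi> (perm_graph d) \<omega>)"
  by (simp add: coeff'_def rev_char_coeff_eq_graph_sum monom_of_def)

lemma coeff_diff_eq: "coeff k \<omega> - coeff' k \<omega> = (\<Sum>d\<in>partial_perms n k. perm_sign k d * monom_diff (perm_graph d) \<omega>)"
  by (simp add: coeff_def coeff'_def rev_char_coeff_eq_graph_sum monom_of_def monom_diff_def
      sum_subtractf[symmetric] right_diff_distrib)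

lemma coeff'_measurable: "coeff' k \<in> borel_measurable M"
  unfolding coeff'_eq[abs_def]
  by (intro borel_measurable_sum borel_measurable_times borel_measurable_const
      monom_of_measurable[OF admissible_phi] perm_graph_subset)

lemma coeff_diff_measurable: "(\<lambda>\<omega>. coeff k \<omega> - coeff' k \<omega>) \<in> borel_measurable M"
  unfolding coeff_diff_eq monom_diff_def
  by (intro borel_measurable_sum borel_measurable_times borel_measurable_const borel_measurable_diff
      monom_of_measurable[OF admissible_phi] monom_of_measurable[OF admissible_id] perm_graph_subset)

lemma perm_graph_neq: "c \<in> partial_perms n k \<Longrightarrow> d \<in> partial_perms n k \<Longrightarrow> c \<noteq> d \<Longrightarrow> perm_graph c \<noteq> perm_graph d"
  using inj_on_perm_graph[of n k] by (auto dest: inj_onD)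

text \<open>By orthogonality the second moment is a sum of at most n^k terms, each at most
  n^(-k).\<close>

lemma coeff'_second_moment:
  "integrable M (\<lambda>\<omega>. (cmod (coeff' k \<omega>))\<^sup>2)" "expectation (\<lambda>\<omega>. (cmod (coeff' k \<omega>))\<^sup>2) \<le> 1"
proof -
  note orth = expectation_orthogonal_sum[of "partial_perms n k" "\<lambda>d. monom_of \<phi> (perm_graph d)" "perm_sign k",
      OF finite_partial_perms monom_of_inner(1)[OF admissible_phi admissible_phi perm_graph_subset perm_graph_subset]
        monom_of_inner(2)[OF admissible_phi admissible_phi perm_graph_subset perm_graph_subset phi_mean phi_mean perm_graph_neq]]
  show "integrable M (\<lambda>\<omega>. (cmod (coeff' k \<omega>))\<^sup>2)"
    unfolding coeff'_eq by (rule orth(1))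
  have "expectation (\<lambda>\<omega>. (cmod (coeff' k \<omega>))\<^sup>2) =
      (\<Sum>d\<in>partial_perms n k. (cmod (perm_sign k d))\<^sup>2 * expectation (\<lambda>\<omega>. (cmod (monom_of \<phi> (perm_graph d) \<omega>))\<^sup>2))"
    unfolding coeff'_eq by (rule orth(2))
  also have "\<dots> \<le> 1"
  proof (rule sum_partial_perms_le)
    fix d assume d: "d \<in> partial_perms n k"
    show "(cmod (perm_sign k d))\<^sup>2 * expectation (\<lambda>\<omega>. (cmod (monom_of \<phi> (perm_graph d) \<omega>))\<^sup>2) \<le> 1 * (1 / n) ^ k"
      using expectation_monom_square_le(2)[OF perm_graph_subset[OF d] admissible_phi
          phi_second_moment[OF subsetD[OF perm_graph_subset[OF d]]]]
      by (simp add: cmod_perm_sign card_perm_graph[OF d])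
  qed simp
  finally show "expectation (\<lambda>\<omega>. (cmod (coeff' k \<omega>))\<^sup>2) \<le> 1" .
qed

text \<open>The monomial differences are again orthogonal, so their errors add up without cross
  terms. The growth k^2 will be absorbed by r^k.\<close>

lemma coeff_diff_second_moment:
  "integrable M (\<lambda>\<omega>. (cmod (coeff k \<omega> - coeff' k \<omega>))\<^sup>2)"
  "expectation (\<lambda>\<omega>. (cmod (coeff k \<omega> - coeff' k \<omega>))\<^sup>2) \<le> (real k)\<^sup>2 * \<tau>"
proof -
  note orth = expectation_orthogonal_sum[of "partial_perms n k" "\<lambda>d. monom_diff (perm_graph d)" "perm_sign k",
      OF finite_partial_perms monom_diff_inner(1)[OF perm_graph_subset perm_graph_subset]
        monom_diff_inner(2)[OF perm_graph_subset perm_graph_subset perm_graph_neq]]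
  show "integrable M (\<lambda>\<omega>. (cmod (coeff k \<omega> - coeff' k \<omega>))\<^sup>2)"
    unfolding coeff_diff_eq by (rule orth(1))
  have "expectation (\<lambda>\<omega>. (cmod (coeff k \<omega> - coeff' k \<omega>))\<^sup>2) =
      (\<Sum>d\<in>partial_perms n k. (cmod (perm_sign k d))\<^sup>2 * expectation (\<lambda>\<omega>. (cmod (monom_diff (perm_graph d) \<omega>))\<^sup>2))"
    unfolding coeff_diff_eq by (rule orth(2))
  also have "\<dots> \<le> (real k)\<^sup>2 * \<tau>"
  proof (rule sum_partial_perms_le)
    fix d assume d: "d \<in> partial_perms n k"
    show "(cmod (perm_sign k d))\<^sup>2 * expectation (\<lambda>\<omega>. (cmod (monom_diff (perm_graph d) \<omega>))\<^sup>2) \<le> (real k)\<^sup>2 * \<tau> * (1 / n) ^ k"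
      using expectation_monom_diff_square_le[OF perm_graph_subset[OF d]]
      by (simp add: cmod_perm_sign card_perm_graph[OF d])
  qed (simp add: tau_nonneg)
  finally show "expectation (\<lambda>\<omega>. (cmod (coeff k \<omega> - coeff' k \<omega>))\<^sup>2) \<le> (real k)\<^sup>2 * \<tau>" .
qed

text \<open>Sorting the factors by edge gives a product of independent variables. An edge used once
  has mean zero; one used at least twice is bounded by its second moment, because
  \<open>\<phi>\<close> is at most 1 in modulus. So each distinct edge costs a factor 1/n, whichever
  of its factors are conjugated.\<close>

lemma expectation_walk_product:
  assumes T: "finite T" and e: "\<And>t. t \<in> T \<Longrightarrow> e t \<in> entries n"
  shows "integrable M (\<lambda>\<omega>. \<Prod>t\<in>T. (if W t then cnj else id) (\<phi> (x (e t) \<omega>)))" (is "integrable M ?F")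
    and "cmod (expectation (\<lambda>\<omega>. \<Prod>t\<in>T. (if W t then cnj else id) (\<phi> (x (e t) \<omega>)))) \<le> 1 / real n ^ card (e ` T)"
proof -
  define h where "h p z = (\<Prod>t\<in>{t\<in>T. e t = p}. (if W t then cnj else id) (\<phi> z))" for p z
  have F: "?F \<omega> = (\<Prod>p\<in>e ` T. h p (x p \<omega>))" for \<omega>
  proof -
    have "?F \<omega> = (\<Prod>p\<in>e ` T. \<Prod>t\<in>{t\<in>T. e t = p}. (if W t then cnj else id) (\<phi> (x (e t) \<omega>)))"
      by (rule prod.image_gen[OF T])
    then show ?thesis by (simp add: h_def)
  qed
  have eT: "e ` T \<subseteq> entries n" using e by blast
  have wm: "(\<lambda>z. (if W t then cnj else id) (\<phi> z)) \<in> borel_measurable borel" for t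
    using phi_measurable borel_measurable_cnj[OF phi_measurable] by (cases "W t") simp_all
  have meas: "h p \<in> borel_measurable borel" for p
    unfolding h_def by (intro borel_measurable_prod wm)
  have norm_h: "cmod (h p z) = cmod (\<phi> z) ^ card {t\<in>T. e t = p}" for p z
  proof -
    have "cmod ((if W t then cnj else id) (\<phi> z)) = cmod (\<phi> z)" for t by simp
    then show ?thesis by (simp add: h_def prod_norm[symmetric])
  qed
  have int: "integrable M (\<lambda>\<omega>. h p (x p \<omega>))" if "p \<in> e ` T" for p
  proof (rule integrable_const_bound[where B = 1])
    show "(\<lambda>\<omega>. h p (x p \<omega>)) \<in> borel_measurable M"
      using that eT by (intro comp_measurable meas) blast
    show "AE \<omega> in M. cmod (h p (x p \<omega>)) \<le> 1"
      by (intro AE_I2) (simp add: norm_h power_le_one phi_bounded)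
  qed
  note prod = expectation_prod[OF eT meas int]
  show "integrable M ?F" unfolding F by (rule prod(2))
  have "cmod (expectation (\<lambda>\<omega>. h p (x p \<omega>))) \<le> 1 / n" if p: "p \<in> e ` T" for p
  proof (cases "card {t\<in>T. e t = p} = 1")
    case True
    then obtain t where t: "{t\<in>T. e t = p} = {t}" by (auto simp: card_1_singleton_iff)
    have pe: "p \<in> entries n" using p eT by blast
    have "expectation (\<lambda>\<omega>. h p (x p \<omega>)) = 0"
      unfolding h_def t using phi_mean[OF pe] by (cases "W t") simp_all
    then show ?thesis by simp
  next
    case False
    have pe: "p \<in> entries n" using p eT by blast
    have "{t\<in>T. e t = p} \<noteq> {}" using p by blast
    then have "card {t\<in>T. e t = p} \<noteq> 0" using T by simp
    with False have 2: "2 \<le> card {t\<in>T. e t = p}" by linarith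
    have "cmod (expectation (\<lambda>\<omega>. h p (x p \<omega>))) \<le> expectation (\<lambda>\<omega>. cmod (h p (x p \<omega>)))"
      by (rule integral_norm_bound)
    also have "\<dots> \<le> expectation (\<lambda>\<omega>. (cmod (\<phi> (x p \<omega>)))\<^sup>2)"
    proof (rule integral_mono)
      show "integrable M (\<lambda>\<omega>. cmod (h p (x p \<omega>)))" using int[OF p] by (rule integrable_norm)
      show "integrable M (\<lambda>\<omega>. (cmod (\<phi> (x p \<omega>)))\<^sup>2)" using admissible_phi pe by (auto simp: admissible_def)
      show "cmod (h p (x p \<omega>)) \<le> (cmod (\<phi> (x p \<omega>)))\<^sup>2" for \<omega>
        unfolding norm_h using 2 phi_bounded by (intro power_decreasing) auto
    qed
    also have "\<dots> \<le> 1 / n" by (rule phi_second_moment[OF pe])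
    finally show ?thesis .
  qed
  then have "(\<Prod>p\<in>e ` T. cmod (expectation (\<lambda>\<omega>. h p (x p \<omega>)))) \<le> (\<Prod>p\<in>e ` T. 1 / n)"
    by (intro prod_mono) auto
  moreover have "expectation ?F = (\<Prod>p\<in>e ` T. expectation (\<lambda>\<omega>. h p (x p \<omega>)))"
    unfolding F by (rule prod(1))
  ultimately show "cmod (expectation ?F) \<le> 1 / real n ^ card (e ` T)"
    by (simp add: prod_norm[symmetric] power_one_over)
qed

lemma trace'_second_moment:
  assumes k: "k > 0"
  shows "integrable M (\<lambda>\<omega>. (cmod (trace' k \<omega>))\<^sup>2)"
    and "expectation (\<lambda>\<omega>. (cmod (trace' k \<omega>))\<^sup>2) \<le> k * k * Suc k + 2 ^ (2 * k * (2 * k)) / n"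
    and "trace' k \<in> borel_measurable M"
proof -
  let ?T = "(UNIV :: bool set) \<times> {..<k}"
  let ?s = "\<lambda>(b :: bool, t). (b, Suc t mod k)"
  let ?G = "\<lambda>h \<omega>. \<Prod>t\<in>?T. (if fst t then cnj else id) (\<phi> (x (h t, h (?s t)) \<omega>))"
  have finT: "finite ?T" by simp
  have sT: "?s t \<in> ?T" if "t \<in> ?T" for t using k by (cases t) simp
  have e: "(h t, h (?s t)) \<in> entries n" if "h \<in> ?T \<rightarrow>\<^sub>E {..<n}" "t \<in> ?T" for h t
    using PiE_mem[OF that] PiE_mem[OF that(1) sT[OF that(2)]] by (simp add: entries_def)
  have sq: "complex_of_real ((cmod (trace' k \<omega>))\<^sup>2) = (\<Sum>h\<in>?T \<rightarrow>\<^sub>E {..<n}. ?G h \<omega>)" for \<omega>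
    unfolding trace'_def trace_pow_closed_walks[OF k] complex_norm_square
    using cmod_closed_walk_sum_squared[where y = "\<lambda>p. \<phi> (x p \<omega>)" and k = k and n = n]
    by (simp only: case_prod_unfold fst_conv snd_conv prod.collapse)
  have intG: "integrable M (?G h)" if "h \<in> ?T \<rightarrow>\<^sub>E {..<n}" for h
    by (rule expectation_walk_product(1)[OF finT e[OF that]])
  have int: "integrable M (\<lambda>\<omega>. \<Sum>h\<in>?T \<rightarrow>\<^sub>E {..<n}. ?G h \<omega>)"
    using intG by (intro Bochner_Integration.integrable_sum)
  then have "integrable M (\<lambda>\<omega>. Re (complex_of_real ((cmod (trace' k \<omega>))\<^sup>2)))"
    unfolding sq by (rule integrable_Re)
  then show "integrable M (\<lambda>\<omega>. (cmod (trace' k \<omega>))\<^sup>2)"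
    unfolding Re_complex_of_real .
  \<comment> \<open>The second moment is a nonnegative real, hence its own modulus; this allows the
    triangle inequality for the complex expectations of the single walk pairs.\<close>
  have "expectation (\<lambda>\<omega>. (cmod (trace' k \<omega>))\<^sup>2) = cmod (complex_of_real (expectation (\<lambda>\<omega>. (cmod (trace' k \<omega>))\<^sup>2)))"
    by simp
  also have "\<dots> = cmod (expectation (\<lambda>\<omega>. \<Sum>h\<in>?T \<rightarrow>\<^sub>E {..<n}. ?G h \<omega>))"
    unfolding sq[symmetric] integral_complex_of_real ..
  also have "\<dots> = cmod (\<Sum>h\<in>?T \<rightarrow>\<^sub>E {..<n}. expectation (?G h))"
    using intG by (subst Bochner_Integration.integral_sum) auto
  also have "\<dots> \<le> (\<Sum>h\<in>?T \<rightarrow>\<^sub>E {..<n}. 1 / real n ^ card ((\<lambda>t. (h t, h (?s t))) ` ?T))"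
    by (intro sum_norm_le expectation_walk_product(2)[OF finT e])
  also have "\<dots> \<le> k * k * Suc k + 2 ^ (2 * k * (2 * k)) / n"
    by (rule sum_closed_walk_pairs_le[OF k n_pos])
  finally show "expectation (\<lambda>\<omega>. (cmod (trace' k \<omega>))\<^sup>2) \<le> k * k * Suc k + 2 ^ (2 * k * (2 * k)) / n" .
  show "trace' k \<in> borel_measurable M"
    unfolding trace'_def[abs_def] trace_pow_closed_walks[OF k]
  proof (intro borel_measurable_sum borel_measurable_prod comp_measurable phi_measurable)
    fix f t assume "f \<in> {..<k} \<rightarrow>\<^sub>E {..<n}" "t \<in> {..<k}"
    then show "(f t, f (Suc t mod k)) \<in> entries n"
      using k PiE_mem[of f "{..<k}" "\<lambda>_. {..<n}"] by (auto simp: entries_def)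
  qed
qed

end

section \<open>Absence of zeros in the disc\<close>

lemma spectral_radius_gt_imp_det_zero:
  fixes X :: "complex mat"
  assumes X: "X \<in> carrier_mat n n" and n: "n > 0" and r: "r > 0" and gt: "spectral_radius X > 1 / r"
  obtains z where "cmod z \<le> r" "det (1\<^sub>m n - z \<cdot>\<^sub>m X) = 0"
proof -
  obtain a where a: "eigenvalue X a" "cmod a = spectral_radius X"
    using spectral_radius_mem_max(1)[OF X n] by (auto simp: spectrum_def)
  have a_gt: "cmod a > 1 / r" using a gt by simp
  moreover have "1 / r > 0" using r by simp
  ultimately have a0: "a \<noteq> 0" by auto
  have cX: "char_matrix X a \<in> carrier_mat n n" using X by (simp add: char_matrix_def)
  have "1\<^sub>m n - (1 / a) \<cdot>\<^sub>m X = (- 1 / a) \<cdot>\<^sub>m char_matrix X a"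
    using X a0 by (intro eq_matI) (auto simp: char_matrix_def field_simps)
  then have "det (1\<^sub>m n - (1 / a) \<cdot>\<^sub>m X) = 0"
    using a(1) eigenvalue_det[OF X] cX by simp
  moreover have "cmod (1 / a) \<le> r"
    using a_gt r a0 by (simp add: norm_divide field_simps)
  ultimately show ?thesis by (intro that[of "1 / a"])
qed

text \<open>The deterministic core, to be applied with the original entries as \<open>v\<close> and
  the truncated ones as \<open>w\<close>. On the disc, exp S bounds the exponential factor, V bounds
  the factor \<open>W\<close> of the derivative, and D bounds q - q'. Integrating the derivative
  from 0 gives |q exp A - 1| <= exp S (V + D) < 1.\<close>

lemma nonvanishing_criterion:
  fixes v w :: "nat \<times> nat \<Rightarrow> complex" and r :: real and m n :: nat
  defines "c \<equiv> rev_char_coeff n w" and "T \<equiv> trace_pow n w"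
  defines "S \<equiv> \<Sum>k=1..m. cmod (T k) * r ^ k / k"
  defines "D \<equiv> \<Sum>b\<le>n. cmod (rev_char_coeff n v b - c b) * r ^ b"
  defines "V \<equiv> \<Sum>j=m..n + m. (real (Suc j) * cmod (c (Suc j)) + (\<Sum>i<m. cmod (T (Suc i)) * cmod (c (j - i)))) * r ^ j"
  assumes r: "0 \<le> r" "r < 1" and small: "exp S * (V + D) < 1" and z: "cmod z \<le> r"
  shows "(\<Sum>b\<le>n. rev_char_coeff n v b * z ^ b) \<noteq> 0"
proof -
  define p where "p = (\<Sum>b\<le>n. monom (c b) b)"
  define a where "a = (\<Sum>i<m. monom (T (Suc i)) i)"
  define W where "W = pderiv p + a * p"
  define A where "A z = (\<Sum>k=1..m. T k * z ^ k / of_nat k)" for z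
  define f where "f z = poly p z * exp (A z)" for z
  have c0: "c 0 = 1" by (simp add: c_def)
  have coeff_p: "Polynomial.coeff p k = c k" for k
    by (cases "k \<le> n") (auto simp: p_def coeff_sum c_def rev_char_coeff_eq_0)
  have coeff_a: "Polynomial.coeff a i = (if i < m then T (Suc i) else 0)" for i
    by (simp add: a_def coeff_sum)
  have coeff_W: "Polynomial.coeff W j = of_nat (Suc j) * c (Suc j) + (\<Sum>i\<le>j. (if i < m then T (Suc i) else 0) * c (j - i))" for j
    by (simp add: W_def coeff_pderiv coeff_mult coeff_p coeff_a)
  \<comment> \<open>\<open>f' = exp A * W\<close>, and Newton's identities say that \<open>W\<close> has no coefficients below \<open>m\<close>.\<close>
  have W_low: "Polynomial.coeff W j = 0" if "j < m" for j
  proof -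
    have "(\<Sum>i\<le>j. (if i < m then T (Suc i) else 0) * c (j - i)) = (\<Sum>i\<le>j. T (Suc i) * c (j - i))"
      using that by (intro sum.cong) auto
    then show ?thesis unfolding coeff_W using newton_identity[of j n w] by (simp add: c_def T_def)
  qed
  have W_high: "cmod (Polynomial.coeff W j) \<le> real (Suc j) * cmod (c (Suc j)) + (\<Sum>i<m. cmod (T (Suc i)) * cmod (c (j - i)))"
    if "m \<le> j" for j
  proof -
    have "(\<Sum>i\<le>j. (if i < m then T (Suc i) else 0) * c (j - i)) = (\<Sum>i<m. T (Suc i) * c (j - i))"
      using that by (intro sum.mono_neutral_cong_right) auto
    then have "cmod (Polynomial.coeff W j) \<le> cmod (of_nat (Suc j) * c (Suc j)) + cmod (\<Sum>i<m. T (Suc i) * c (j - i))"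
      unfolding coeff_W by (simp only: norm_triangle_ineq)
    also have "cmod (\<Sum>i<m. T (Suc i) * c (j - i)) \<le> (\<Sum>i<m. cmod (T (Suc i)) * cmod (c (j - i)))"
      by (intro order.trans[OF norm_sum] sum_mono) (simp add: norm_mult)
    finally show ?thesis by (simp add: norm_mult del: of_nat_Suc)
  qed
  \<comment> \<open>These degrees give the upper limit \<open>n + m\<close> of the sum in V; its
    lower limit comes from the vanishing of the low coefficients.\<close>
  have "degree p \<le> n" "degree a \<le> m"
    by (auto intro!: degree_le simp: coeff_p coeff_a c_def rev_char_coeff_eq_0)
  then have degW: "degree W \<le> n + m"
    unfolding W_def
    by (intro degree_add_le order.trans[OF degree_mult_le]) (auto simp: degree_pderiv)
  have W_le: "cmod (poly W y) \<le> V" if y: "cmod y \<le> r" for y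
  proof -
    have "poly W y = (\<Sum>j\<le>n + m. Polynomial.coeff W j * y ^ j)"
      unfolding poly_altdef using degW by (intro sum.mono_neutral_left) (auto simp: coeff_eq_0)
    also have "\<dots> = (\<Sum>j=m..n + m. Polynomial.coeff W j * y ^ j)"
      using W_low by (intro sum.mono_neutral_right) auto
    finally have "cmod (poly W y) \<le> (\<Sum>j=m..n + m. cmod (Polynomial.coeff W j) * cmod y ^ j)"
      by (simp add: order.trans[OF norm_sum] norm_mult norm_power)
    also have "\<dots> \<le> V"
      unfolding V_def using W_high y
      by (intro sum_mono mult_mono power_mono) (auto intro!: add_nonneg_nonneg sum_nonneg)
    finally show ?thesis .
  qed
  have A_le: "cmod (exp (A y)) \<le> exp S" if y: "cmod y \<le> r" for y
  proof -
    have "cmod (A y) \<le> (\<Sum>k=1..m. cmod (T k) * cmod y ^ k / k)"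
      unfolding A_def by (intro order.trans[OF norm_sum] sum_mono) (simp add: norm_mult norm_divide norm_power)
    also have "\<dots> \<le> S"
      unfolding S_def using y by (intro sum_mono divide_right_mono mult_left_mono power_mono) auto
    finally have "cmod (A y) \<le> S" .
    then have "Re (A y) \<le> S" using complex_Re_le_cmod[of "A y"] by linarith
    then show ?thesis by simp
  qed
  have dA: "(A has_field_derivative poly a y) (at y)" for y
  proof -
    have "((\<lambda>z. \<Sum>k=1..m. T k * z ^ k / of_nat k) has_field_derivative (\<Sum>k=1..m. T k * y ^ (k - 1))) (at y)"
      by (rule DERIV_sum) (auto intro!: derivative_eq_intros)
    moreover have "(\<Sum>k=1..m. T k * y ^ (k - 1)) = poly a y"
      unfolding a_def poly_sum poly_monom
      by (rule sum.reindex_bij_witness[where i = Suc and j = "\<lambda>k. k - 1"]) auto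
    ultimately show ?thesis by (simp add: A_def[abs_def])
  qed
  have df: "(f has_field_derivative exp (A y) * poly W y) (at y within cball 0 r)" for y
  proof -
    have "(f has_field_derivative poly (pderiv p) y * exp (A y) + exp (A y) * poly a y * poly p y) (at y)"
      unfolding f_def[abs_def] using DERIV_mult[OF poly_DERIV[of p y] DERIV_fun_exp[OF dA[of y]]] by simp
    also have "poly (pderiv p) y * exp (A y) + exp (A y) * poly a y * poly p y = exp (A y) * poly W y"
      by (simp add: W_def algebra_simps)
    finally show ?thesis by (rule has_field_derivative_at_within)
  qed
  have V0: "V \<ge> 0" using order.trans[OF norm_ge_zero W_le[of 0]] r by simp
  have "cmod (f z - f 0) \<le> (exp S * V) * cmod (z - 0)"
  proof (rule field_differentiable_bound[OF convex_cball df])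
    fix y :: complex assume "y \<in> cball 0 r"
    then have "cmod y \<le> r" by simp
    then show "cmod (exp (A y) * poly W y) \<le> exp S * V"
      unfolding norm_mult using A_le W_le by (intro mult_mono) auto
  qed (use z r in auto)
  also have "\<dots> \<le> (exp S * V) * 1" using z r V0 by (intro mult_left_mono) auto
  finally have f_le: "cmod (f z - f 0) \<le> exp S * V" by simp
  have f0: "f 0 = 1"
  proof -
    have "A 0 = 0" by (auto simp: A_def intro!: sum.neutral)
    moreover have "poly p 0 = 1" using c0 coeff_p[of 0] by (simp add: poly_0_coeff_0)
    ultimately show ?thesis by (simp add: f_def)
  qed
  define q where "q = (\<Sum>b\<le>n. rev_char_coeff n v b * z ^ b)"
  have "q - poly p z = (\<Sum>b\<le>n. (rev_char_coeff n v b - c b) * z ^ b)"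
    by (simp add: q_def p_def poly_sum poly_monom sum_subtractf left_diff_distrib)
  then have "cmod (q - poly p z) \<le> (\<Sum>b\<le>n. cmod (rev_char_coeff n v b - c b) * cmod z ^ b)"
    by (simp add: order.trans[OF norm_sum] norm_mult norm_power)
  also have "\<dots> \<le> D"
    unfolding D_def using z by (intro sum_mono mult_left_mono power_mono) auto
  finally have q_le: "cmod (q - poly p z) \<le> D" .
  have "q * exp (A z) - 1 = (f z - f 0) + exp (A z) * (q - poly p z)"
    by (simp add: f0) (simp add: f_def algebra_simps)
  then have "cmod (q * exp (A z) - 1) \<le> cmod (f z - f 0) + cmod (exp (A z)) * cmod (q - poly p z)"
    by (metis norm_mult norm_triangle_ineq)
  also have "\<dots> \<le> exp S * V + exp S * D"
    using f_le A_le[OF z] q_le by (intro add_mono mult_mono) auto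
  also have "\<dots> < 1" using small by (simp add: distrib_left)
  finally have "q * exp (A z) \<noteq> 0" by (metis diff_0 norm_minus_cancel norm_one less_irrefl)
  then show ?thesis by (simp add: q_def)
qed

text \<open>Dictated by V: differentiation produces \<open>Suc j\<close> times a coefficient of L^1
  norm at most 1, and the convolution has at most \<open>j\<close> products, each of expectation at
  most 2 j^3. The summands of S and D are dominated by the same series.\<close>

definition majorant :: "real \<Rightarrow> nat \<Rightarrow> real" where
  "majorant r j = (real (Suc j) + 2 * real j ^ 4) * r ^ j"

lemma summable_majorant:
  assumes r: "0 < r" "r < 1"
  shows "summable (majorant r)"
proof -
  \<comment> \<open>Any constant strictly between \<open>r\<close> and 1 serves: the polynomial
    factor has ratio tending to 1, which is eventually below \<open>c / r\<close>.\<close>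
  define c where "c = (1 + r) / 2"
  have c: "r < c" "c < 1" using r by (simp_all add: c_def)
  let ?a = "\<lambda>j :: nat. real (Suc j) + 2 * real j ^ 4"
  have "(\<lambda>j. ?a (Suc j) / ?a j) \<longlonglongrightarrow> 1" by real_asymp
  moreover have "1 < c / r" using c r by simp
  ultimately have "\<forall>\<^sub>F j in sequentially. ?a (Suc j) / ?a j < c / r"
    by (rule order_tendstoD)
  then obtain N where N: "\<And>j. j \<ge> N \<Longrightarrow> ?a (Suc j) / ?a j < c / r"
    by (auto simp: eventually_sequentially)
  have apos: "?a j > 0" for j by (intro add_pos_nonneg) auto
  show ?thesis
  proof (rule summable_ratio_test[OF c(2)])
    fix j assume "j \<ge> N"
    from N[OF this] have "?a (Suc j) * r \<le> c * ?a j"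
      using apos[of j] r by (simp add: field_simps)
    then have "(?a (Suc j) * r) * r ^ j \<le> (c * ?a j) * r ^ j"
      using r by (intro mult_right_mono) auto
    moreover have "majorant r i \<ge> 0" for i
      using r by (simp add: majorant_def)
    ultimately show "norm (majorant r (Suc j)) \<le> c * norm (majorant r j)"
      unfolding real_norm_def by (simp only: abs_of_nonneg) (simp only: majorant_def power_Suc mult_ac)
  qed
qed

lemma majorant_nonneg: "0 \<le> r \<Longrightarrow> 0 \<le> majorant r j"
  by (simp add: majorant_def)

lemma real_le_fourth_power: "real k \<le> real k ^ 4"
proof -
  have "k \<le> k ^ 4" by (cases "k = 0") (auto intro: self_le_power)
  then show ?thesis unfolding of_nat_power[symmetric] of_nat_le_iff .
qed

text \<open>For a trace and a coefficient of the same matrix, which are dependent. The inequality 2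
  x y <= x^2 + y^2 replaces Cauchy-Schwarz, since any polynomial bound will do.\<close>

lemma (in prob_space) expectation_mult_le:
  fixes X Y :: "'a \<Rightarrow> complex"
  assumes X: "X \<in> borel_measurable M" "integrable M (\<lambda>\<omega>. (cmod (X \<omega>))\<^sup>2)" "expectation (\<lambda>\<omega>. (cmod (X \<omega>))\<^sup>2) \<le> a"
    and Y: "Y \<in> borel_measurable M" "integrable M (\<lambda>\<omega>. (cmod (Y \<omega>))\<^sup>2)" "expectation (\<lambda>\<omega>. (cmod (Y \<omega>))\<^sup>2) \<le> b"
  shows "integrable M (\<lambda>\<omega>. cmod (X \<omega>) * cmod (Y \<omega>))"
    and "expectation (\<lambda>\<omega>. cmod (X \<omega>) * cmod (Y \<omega>)) \<le> (a + b) / 2"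
proof -
  have le: "cmod (X \<omega>) * cmod (Y \<omega>) \<le> ((cmod (X \<omega>))\<^sup>2 + (cmod (Y \<omega>))\<^sup>2) / 2" for \<omega>
    using sum_squares_bound[of "cmod (X \<omega>)" "cmod (Y \<omega>)"] by simp
  have int: "integrable M (\<lambda>\<omega>. ((cmod (X \<omega>))\<^sup>2 + (cmod (Y \<omega>))\<^sup>2) / 2)"
    using X(2) Y(2) by (intro integrable_divide Bochner_Integration.integrable_add)
  show int': "integrable M (\<lambda>\<omega>. cmod (X \<omega>) * cmod (Y \<omega>))"
  proof (rule Bochner_Integration.integrable_bound[OF int])
    show "(\<lambda>\<omega>. cmod (X \<omega>) * cmod (Y \<omega>)) \<in> borel_measurable M"
      using X(1) Y(1) by measurable
    show "AE \<omega> in M. norm (cmod (X \<omega>) * cmod (Y \<omega>)) \<le> norm (((cmod (X \<omega>))\<^sup>2 + (cmod (Y \<omega>))\<^sup>2) / 2)"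
      using le by (intro AE_I2) simp
  qed
  have "expectation (\<lambda>\<omega>. cmod (X \<omega>) * cmod (Y \<omega>)) \<le> expectation (\<lambda>\<omega>. ((cmod (X \<omega>))\<^sup>2 + (cmod (Y \<omega>))\<^sup>2) / 2)"
    by (rule integral_mono[OF int' int le])
  also have "\<dots> = (expectation (\<lambda>\<omega>. (cmod (X \<omega>))\<^sup>2) + expectation (\<lambda>\<omega>. (cmod (Y \<omega>))\<^sup>2)) / 2"
    using X(2) Y(2) by simp
  also have "\<dots> \<le> (a + b) / 2" using X(3) Y(3) by simp
  finally show "expectation (\<lambda>\<omega>. cmod (X \<omega>) * cmod (Y \<omega>)) \<le> (a + b) / 2" .
qed

section \<open>Expectations of S, D and V, and Markov's inequality\<close>

context truncated_array
begin

text \<open>\<open>n_large\<close> makes the remainder 2^(4 k^2) / n of the walk count at most 1 for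
  all \<open>k \<le> m\<close> simultaneously.\<close>

context
  fixes r :: real and m :: nat
  assumes r: "0 < r" "r < 1" and n_large: "2 ^ (2 * m * (2 * m)) \<le> n"
begin

lemma trace'_bounds:
  assumes k: "0 < k" "k \<le> m"
  shows "expectation (\<lambda>\<omega>. (cmod (trace' k \<omega>))\<^sup>2) \<le> 3 * real k ^ 3"
    and "integrable M (\<lambda>\<omega>. cmod (trace' k \<omega>))"
    and "expectation (\<lambda>\<omega>. cmod (trace' k \<omega>)) \<le> 2 * real k ^ 2"
proof -
  have k1: "real k \<ge> 1" using k by simp
  have "2 ^ (2 * k * (2 * k)) \<le> (2 :: nat) ^ (2 * m * (2 * m))"
    using k by (intro power_increasing mult_le_mono) auto
  with n_large have "2 ^ (2 * k * (2 * k)) \<le> n" by linarith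
  then have "2 ^ (2 * k * (2 * k)) / real n \<le> 1"
    using n_pos by (simp add: divide_le_eq_1)
  moreover have "real (k * k * Suc k) + 1 \<le> 3 * real k ^ 3"
  proof -
    have "real k ^ 2 \<le> real k ^ 3" "1 \<le> real k ^ 3" using k1 by (intro power_increasing one_le_power; simp)+
    then show ?thesis by (simp add: power2_eq_square power3_eq_cube algebra_simps)
  qed
  ultimately show sq: "expectation (\<lambda>\<omega>. (cmod (trace' k \<omega>))\<^sup>2) \<le> 3 * real k ^ 3"
    using trace'_second_moment(2)[OF k(1)] by linarith
  \<comment> \<open>Rounded up to a perfect square, so that the L^1 bound is free of roots.\<close>
  have "3 * real k ^ 3 \<le> 4 * real k ^ 4"
    using k1 power_increasing[of 3 4 "real k"] zero_le_power[of "real k" 4] by linarith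
  also have "\<dots> = (2 * real k ^ 2)\<^sup>2" by (simp add: power_mult_distrib flip: power_mult)
  finally have "expectation (\<lambda>\<omega>. (cmod (trace' k \<omega>))\<^sup>2) \<le> (2 * real k ^ 2)\<^sup>2" using sq by linarith
  from expectation_le_of_square[OF trace'_second_moment(3)[OF k(1)] trace'_second_moment(1)[OF k(1)] this]
  show "integrable M (\<lambda>\<omega>. cmod (trace' k \<omega>))" "expectation (\<lambda>\<omega>. cmod (trace' k \<omega>)) \<le> 2 * real k ^ 2"
    by simp_all
qed

text \<open>The random versions of the quantities \<open>S\<close>, \<open>D\<close>, \<open>V\<close> of \<open>nonvanishing_criterion\<close>.\<close>

definition S_fun :: "'a \<Rightarrow> real" where
  "S_fun \<omega> = (\<Sum>k=1..m. cmod (trace' k \<omega>) * r ^ k / k)"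

definition D_fun :: "'a \<Rightarrow> real" where
  "D_fun \<omega> = (\<Sum>b\<le>n. cmod (coeff b \<omega> - coeff' b \<omega>) * r ^ b)"

definition V_fun :: "'a \<Rightarrow> real" where
  "V_fun \<omega> = (\<Sum>j=m..n + m. (real (Suc j) * cmod (coeff' (Suc j) \<omega>) +
     (\<Sum>i<m. cmod (trace' (Suc i) \<omega>) * cmod (coeff' (j - i) \<omega>))) * r ^ j)"

text \<open>The bound does not involve \<open>m\<close>, so the level L for S can be fixed before
  \<open>m\<close>.\<close>

lemma S_fun_bound: "integrable M S_fun" "expectation S_fun \<le> suminf (majorant r)"
proof -
  have int: "integrable M (\<lambda>\<omega>. cmod (trace' k \<omega>) * r ^ k / k)" if "k \<in> {1..m}" for k
    using trace'_bounds(2)[of k] that by (intro integrable_divide integrable_mult_left) auto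
  then show "integrable M S_fun"
    unfolding S_fun_def[abs_def] by (intro Bochner_Integration.integrable_sum)
  have "expectation S_fun = (\<Sum>k=1..m. expectation (\<lambda>\<omega>. cmod (trace' k \<omega>) * r ^ k / k))"
    unfolding S_fun_def[abs_def] using int by (rule Bochner_Integration.integral_sum)
  also have "\<dots> \<le> (\<Sum>k=1..m. majorant r k)"
  proof (rule sum_mono)
    fix k assume k: "k \<in> {1..m}"
    have "expectation (\<lambda>\<omega>. cmod (trace' k \<omega>) * r ^ k / k) = expectation (\<lambda>\<omega>. cmod (trace' k \<omega>)) * (r ^ k / k)"
      by simp
    also have "\<dots> \<le> (2 * real k ^ 2) * (r ^ k / k)"
      using trace'_bounds(3)[of k] k r by (intro mult_right_mono) auto
    also have "\<dots> = (2 * real k) * r ^ k" using k by (simp add: power2_eq_square)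
    also have "2 * real k \<le> real (Suc k) + 2 * real k ^ 4"
      using real_le_fourth_power[of k] zero_le_power[of "real k" 4] by linarith
    then have "2 * real k * r ^ k \<le> majorant r k"
      unfolding majorant_def using r by (intro mult_right_mono) auto
    finally show "expectation (\<lambda>\<omega>. cmod (trace' k \<omega>) * r ^ k / k) \<le> majorant r k" .
  qed
  also have "\<dots> \<le> suminf (majorant r)"
    using r by (intro sum_le_suminf summable_majorant) (auto simp: majorant_nonneg)
  finally show "expectation S_fun \<le> suminf (majorant r)" .
qed

lemma D_fun_bound: "integrable M D_fun" "expectation D_fun \<le> sqrt \<tau> * suminf (majorant r)"
proof -
  have E: "integrable M (\<lambda>\<omega>. cmod (coeff b \<omega> - coeff' b \<omega>))"
    "expectation (\<lambda>\<omega>. cmod (coeff b \<omega> - coeff' b \<omega>)) \<le> b * sqrt \<tau>" for b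
    using expectation_le_of_square[OF coeff_diff_measurable[of b] coeff_diff_second_moment(1)[of b], of "b * sqrt \<tau>"]
      coeff_diff_second_moment(2)[of b] tau_nonneg by (simp_all add: power_mult_distrib)
  have int: "integrable M (\<lambda>\<omega>. cmod (coeff b \<omega> - coeff' b \<omega>) * r ^ b)" for b
    using E(1) by (rule integrable_mult_left)
  then show "integrable M D_fun"
    unfolding D_fun_def[abs_def] by (intro Bochner_Integration.integrable_sum)
  have "expectation D_fun = (\<Sum>b\<le>n. expectation (\<lambda>\<omega>. cmod (coeff b \<omega> - coeff' b \<omega>) * r ^ b))"
    unfolding D_fun_def[abs_def] using int by (rule Bochner_Integration.integral_sum)
  also have "\<dots> \<le> (\<Sum>b\<le>n. sqrt \<tau> * majorant r b)"
  proof (rule sum_mono)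
    fix b
    have "expectation (\<lambda>\<omega>. cmod (coeff b \<omega> - coeff' b \<omega>) * r ^ b) = expectation (\<lambda>\<omega>. cmod (coeff b \<omega> - coeff' b \<omega>)) * r ^ b"
      by simp
    also have "\<dots> \<le> (b * sqrt \<tau>) * r ^ b" using E(2)[of b] r by (intro mult_right_mono) auto
    also have "\<dots> = sqrt \<tau> * (b * r ^ b)" by simp
    also have "\<dots> \<le> sqrt \<tau> * majorant r b"
      unfolding majorant_def using r tau_nonneg by (intro mult_left_mono mult_right_mono) auto
    finally show "expectation (\<lambda>\<omega>. cmod (coeff b \<omega> - coeff' b \<omega>) * r ^ b) \<le> sqrt \<tau> * majorant r b" .
  qed
  also have "\<dots> = sqrt \<tau> * (\<Sum>b\<le>n. majorant r b)" by (rule sum_distrib_left[symmetric])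
  also have "\<dots> \<le> sqrt \<tau> * suminf (majorant r)"
    using r tau_nonneg by (intro mult_left_mono sum_le_suminf summable_majorant) (auto simp: majorant_nonneg)
  finally show "expectation D_fun \<le> sqrt \<tau> * suminf (majorant r)" .
qed

text \<open>Newton's identities leave only powers \<open>j \<ge> m\<close>, so the expectation is at
  most a tail of a convergent series and can be made small through \<open>m\<close>, uniformly in
  the admissible \<open>n\<close>.\<close>

lemma V_fun_bound: "integrable M V_fun" "expectation V_fun \<le> (\<Sum>i. majorant r (i + m))"
proof -
  let ?C = "\<lambda>j \<omega>. real (Suc j) * cmod (coeff' (Suc j) \<omega>)"
  let ?P = "\<lambda>j i \<omega>. cmod (trace' (Suc i) \<omega>) * cmod (coeff' (j - i) \<omega>)"
  have C: "integrable M (\<lambda>\<omega>. cmod (coeff' k \<omega>))" "expectation (\<lambda>\<omega>. cmod (coeff' k \<omega>)) \<le> 1" for k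
    using expectation_le_of_square[OF coeff'_measurable[of k] coeff'_second_moment(1)[of k], of 1]
      coeff'_second_moment(2)[of k] by simp_all
  have P: "integrable M (?P j i)" "expectation (?P j i) \<le> 2 * real j ^ 3" if "i < m" "m \<le> j" for i j
  proof -
    have i: "0 < Suc i" "Suc i \<le> m" using that by auto
    note prod = expectation_mult_le[OF trace'_second_moment(3)[OF i(1)] trace'_second_moment(1)[OF i(1)] trace'_bounds(1)[OF i]
        coeff'_measurable[of "j - i"] coeff'_second_moment(1)[of "j - i"] coeff'_second_moment(2)[of "j - i"]]
    show "integrable M (?P j i)" by (rule prod(1))
    have "real (Suc i) ^ 3 \<le> real j ^ 3" "1 \<le> real j ^ 3"
      using that by (intro power_mono one_le_power; simp)+
    \<comment> \<open>Here \<open>a\<close> is the cube of \<open>Suc i\<close>, from the trace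
      bound, the 1 is the coefficient bound, and \<open>b\<close> is the cube of \<open>j\<close>;
      \<open>Suc i \<le> m \<le> j\<close> provides the comparison.\<close>
    moreover have "(3 * a + 1) / 2 \<le> 2 * b" if "a \<le> b" "1 \<le> b" for a b :: real
      using that by simp
    ultimately show "expectation (?P j i) \<le> 2 * real j ^ 3"
      using prod(2) by (blast intro: order.trans)
  qed
  have intj: "integrable M (\<lambda>\<omega>. ?C j \<omega> + (\<Sum>i<m. ?P j i \<omega>))" if "m \<le> j" for j
    using C P(1) that by (intro Bochner_Integration.integrable_add Bochner_Integration.integrable_sum integrable_mult_right) auto
  have int: "integrable M (\<lambda>\<omega>. (?C j \<omega> + (\<Sum>i<m. ?P j i \<omega>)) * r ^ j)" if "j \<in> {m..n + m}" for j
    using intj[of j] that by (intro integrable_mult_left) auto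
  then show "integrable M V_fun"
    unfolding V_fun_def[abs_def] by (intro Bochner_Integration.integrable_sum)
  have "expectation V_fun = (\<Sum>j=m..n + m. expectation (\<lambda>\<omega>. (?C j \<omega> + (\<Sum>i<m. ?P j i \<omega>)) * r ^ j))"
    unfolding V_fun_def[abs_def] using int by (rule Bochner_Integration.integral_sum)
  also have "\<dots> \<le> (\<Sum>j=m..n + m. majorant r j)"
  proof (rule sum_mono)
    fix j assume "j \<in> {m..n + m}"
    then have j: "m \<le> j" by simp
    have "expectation (\<lambda>\<omega>. ?C j \<omega> + (\<Sum>i<m. ?P j i \<omega>)) = expectation (?C j) + expectation (\<lambda>\<omega>. \<Sum>i<m. ?P j i \<omega>)"
      using C P(1) j by (intro Bochner_Integration.integral_add Bochner_Integration.integrable_sum integrable_mult_right) auto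
    also have "expectation (\<lambda>\<omega>. \<Sum>i<m. ?P j i \<omega>) = (\<Sum>i<m. expectation (?P j i))"
      using P(1) j by (intro Bochner_Integration.integral_sum) auto
    also have "\<dots> \<le> (\<Sum>i<m. 2 * real j ^ 3)"
      using P(2) j by (intro sum_mono) auto
    \<comment> \<open>The number \<open>m\<close> of summands is replaced by \<open>j\<close>, which
      makes the bound independent of \<open>m\<close>.\<close>
    also have "\<dots> \<le> real j * (2 * real j ^ 3)"
      using j by (simp add: mult_right_mono)
    also have "\<dots> = 2 * real j ^ 4" by (simp add: power_Suc[symmetric] eval_nat_numeral)
    also have "expectation (?C j) = real (Suc j) * expectation (\<lambda>\<omega>. cmod (coeff' (Suc j) \<omega>))"
      by simp
    also have "\<dots> \<le> real (Suc j) * 1" using C(2)[of "Suc j"] by (intro mult_left_mono) auto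
    finally have "expectation (\<lambda>\<omega>. ?C j \<omega> + (\<Sum>i<m. ?P j i \<omega>)) \<le> real (Suc j) + 2 * real j ^ 4" by simp
    then have "expectation (\<lambda>\<omega>. ?C j \<omega> + (\<Sum>i<m. ?P j i \<omega>)) * r ^ j \<le> majorant r j"
      unfolding majorant_def using r by (intro mult_right_mono) auto
    then show "expectation (\<lambda>\<omega>. (?C j \<omega> + (\<Sum>i<m. ?P j i \<omega>)) * r ^ j) \<le> majorant r j"
      by (simp only: integral_mult_left_zero)
  qed
  also have "\<dots> = (\<Sum>i\<le>n. majorant r (i + m))"
    using sum.shift_bounds_cl_nat_ivl[of "majorant r" 0 m n] by (simp add: atLeast0AtMost)
  also have "\<dots> \<le> (\<Sum>i. majorant r (i + m))"
    using r by (intro sum_le_suminf summable_ignore_initial_segment summable_majorant) (auto simp: majorant_nonneg)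
  finally show "expectation V_fun \<le> (\<Sum>i. majorant r (i + m))" .
qed

text \<open>No bound for the expectation of exp S is available, so S is first cut off at level L.
  Off the event S >= L it is enough that V + D < exp (- L), and both exceptional events are handled
  by Markov's inequality.\<close>

lemma prob_spectral_radius_le:
  assumes L: "L > 0"
  shows "measure M {\<omega> \<in> space M. spectral_radius (mat n n (\<lambda>p. x p \<omega>)) > 1 / r} \<le>
    suminf (majorant r) / L + exp L * ((\<Sum>i. majorant r (i + m)) + sqrt \<tau> * suminf (majorant r))"
proof -
  let ?A = "{\<omega> \<in> space M. spectral_radius (mat n n (\<lambda>p. x p \<omega>)) > 1 / r}"
  let ?B = "{\<omega> \<in> space M. S_fun \<omega> \<ge> L}"
  let ?C = "{\<omega> \<in> space M. V_fun \<omega> + D_fun \<omega> \<ge> exp (- L)}"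
  have S0: "S_fun \<omega> \<ge> 0" and VD0: "V_fun \<omega> + D_fun \<omega> \<ge> 0" for \<omega>
    using r unfolding S_fun_def V_fun_def D_fun_def
    by (intro sum_nonneg add_nonneg_nonneg mult_nonneg_nonneg divide_nonneg_nonneg; simp)+
  have intVD: "integrable M (\<lambda>\<omega>. V_fun \<omega> + D_fun \<omega>)"
    using V_fun_bound(1) D_fun_bound(1) by (rule Bochner_Integration.integrable_add)
  have B: "?B \<in> events" using S_fun_bound(1) by measurable
  have C: "?C \<in> events" using intVD by measurable
  have sub: "?A \<subseteq> ?B \<union> ?C"
  proof (rule subsetI, rule ccontr)
    fix \<omega> assume A: "\<omega> \<in> ?A" and not: "\<omega> \<notin> ?B \<union> ?C"
    then have "S_fun \<omega> < L" "V_fun \<omega> + D_fun \<omega> < exp (- L)" by auto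
    then have "exp (S_fun \<omega>) * (V_fun \<omega> + D_fun \<omega>) \<le> exp L * (V_fun \<omega> + D_fun \<omega>)"
      using VD0 by (intro mult_right_mono) auto
    also have "\<dots> < exp L * exp (- L)"
      using \<open>V_fun \<omega> + D_fun \<omega> < exp (- L)\<close> by simp
    finally have small: "exp (S_fun \<omega>) * (V_fun \<omega> + D_fun \<omega>) < 1" by (simp add: exp_minus)
    obtain z where z: "cmod z \<le> r" "det (1\<^sub>m n - z \<cdot>\<^sub>m mat n n (\<lambda>p. x p \<omega>)) = 0"
      using spectral_radius_gt_imp_det_zero[of "mat n n (\<lambda>p. x p \<omega>)" n r] A r n_pos by auto
    have "(\<Sum>b\<le>n. rev_char_coeff n (\<lambda>p. x p \<omega>) b * z ^ b) \<noteq> 0"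
      using nonvanishing_criterion[where r = r and m = m and n = n and w = "\<lambda>p. \<phi> (x p \<omega>)" and v = "\<lambda>p. x p \<omega>" and z = z] r z(1) small
      unfolding S_fun_def V_fun_def D_fun_def trace'_def coeff_def coeff'_def by simp
    with z(2) show False by (simp add: det_one_minus_smult)
  qed
  have "measure M ?A \<le> measure M (?B \<union> ?C)"
  \<comment> \<open>Measurability of the spectral radius is not established. Outside the
    sigma-algebra \<open>measure\<close> takes the value 0, and the inequality is trivial.\<close>
  proof (cases "?A \<in> events")
    case True
    then show ?thesis using sub B C by (intro finite_measure_mono) auto
  qed (simp add: measure_notin_sets)
  also have "\<dots> \<le> measure M ?B + measure M ?C"
    using B C by (rule measure_Un_le)
  also have "measure M ?B \<le> expectation S_fun / L"
    using integral_Markov_inequality_measure[OF S_fun_bound(1) sets.top _ L] S0 by simp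
  also have "\<dots> \<le> suminf (majorant r) / L"
    using S_fun_bound(2) L by (intro divide_right_mono) auto
  also have "measure M ?C \<le> expectation (\<lambda>\<omega>. V_fun \<omega> + D_fun \<omega>) / exp (- L)"
    using integral_Markov_inequality_measure[OF intVD sets.top, of "exp (- L)"] VD0 by simp
  also have "\<dots> = exp L * (expectation V_fun + expectation D_fun)"
    using V_fun_bound(1) D_fun_bound(1) by (simp add: exp_minus field_simps)
  also have "\<dots> \<le> exp L * ((\<Sum>i. majorant r (i + m)) + sqrt \<tau> * suminf (majorant r))"
    using V_fun_bound(2) D_fun_bound(2) by (intro mult_left_mono add_mono) auto
  finally show ?thesis by simp
qed

end

end

section \<open>Sparse matrices\<close>

text \<open>The two arrays are first merged into one family \<open>Z\<close> over
  \<open>UNIV \<times> I\<close>. It is independent because a rectangle probability splits between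
  the arrays and then within each array. Regrouping \<open>Z\<close> into the disjoint pairs of
  indices at each position gives the claim.\<close>

lemma (in prob_space) indep_vars_combine_arrays:
  fixes a b :: "'i \<Rightarrow> 'a \<Rightarrow> complex"
  assumes I: "finite I" "I \<noteq> {}"
    and a: "indep_vars (\<lambda>_. borel) a I" and b: "indep_vars (\<lambda>_. borel) b I"
    and ab: "indep_var (\<Pi>\<^sub>M i\<in>I. borel) (\<lambda>\<omega>. \<lambda>i\<in>I. a i \<omega>) (\<Pi>\<^sub>M i\<in>I. borel) (\<lambda>\<omega>. \<lambda>i\<in>I. b i \<omega>)"
    and f: "case_prod f \<in> borel_measurable (borel \<Otimes>\<^sub>M borel)"
  shows "indep_vars (\<lambda>_. borel) (\<lambda>i \<omega>. f (a i \<omega>) (b i \<omega>) :: complex) I"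
proof -
  define Z where "Z = (\<lambda>(c, i). if c then a i else b i)"
  let ?J = "(UNIV :: bool set) \<times> I"
  have am: "random_variable borel (a i)" and bm: "random_variable borel (b i)" if "i \<in> I" for i
    using a b that by (auto simp: indep_vars_def)
  have Z: "indep_vars (\<lambda>_. borel) Z ?J"
  proof (subst indep_vars_finite[where E = "\<lambda>_. sets borel"])
    show "\<forall>A\<in>?J \<rightarrow> sets borel. prob (\<Inter>j\<in>?J. Z j -` A j \<inter> space M) = (\<Prod>j\<in>?J. prob (Z j -` A j \<inter> space M))"
    proof
      fix A :: "bool \<times> 'i \<Rightarrow> complex set" assume "A \<in> ?J \<rightarrow> sets borel"
      then have A: "A (c, i) \<in> sets borel" if "i \<in> I" for c i using that by auto
      let ?X = "\<lambda>c. \<Pi>\<^sub>E i\<in>I. A (c, i)"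
      have X: "?X c \<in> sets (\<Pi>\<^sub>M i\<in>I. borel)" for c
        using A I(1) by (intro sets_PiM_I_finite) auto
      have eq1: "(\<lambda>\<omega>. \<lambda>i\<in>I. a i \<omega>) -` ?X True \<inter> space M = (\<Inter>i\<in>I. a i -` A (True, i) \<inter> space M)"
        and eq2: "(\<lambda>\<omega>. \<lambda>i\<in>I. b i \<omega>) -` ?X False \<inter> space M = (\<Inter>i\<in>I. b i -` A (False, i) \<inter> space M)"
        using I(2) by (auto simp: PiE_iff)
      have "(\<Inter>j\<in>?J. Z j -` A j \<inter> space M) =
          (\<lambda>\<omega>. (\<lambda>i\<in>I. a i \<omega>, \<lambda>i\<in>I. b i \<omega>)) -` (?X True \<times> ?X False) \<inter> space M"
      proof (rule antisym; rule subsetI)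
        fix \<omega> assume *: "\<omega> \<in> (\<Inter>j\<in>?J. Z j -` A j \<inter> space M)"
        have "a i \<omega> \<in> A (True, i)" "b i \<omega> \<in> A (False, i)" "\<omega> \<in> space M" if "i \<in> I" for i
          using INT_D[OF *, of "(True, i)"] INT_D[OF *, of "(False, i)"] that by (simp_all add: Z_def)
        then show "\<omega> \<in> (\<lambda>\<omega>. (\<lambda>i\<in>I. a i \<omega>, \<lambda>i\<in>I. b i \<omega>)) -` (?X True \<times> ?X False) \<inter> space M"
          using I(2) by auto
      next
        fix \<omega> assume *: "\<omega> \<in> (\<lambda>\<omega>. (\<lambda>i\<in>I. a i \<omega>, \<lambda>i\<in>I. b i \<omega>)) -` (?X True \<times> ?X False) \<inter> space M"
        then have "a i \<omega> \<in> A (True, i)" "b i \<omega> \<in> A (False, i)" if "i \<in> I" for i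
          using that by (auto simp: PiE_iff)
        with * show "\<omega> \<in> (\<Inter>j\<in>?J. Z j -` A j \<inter> space M)"
          by (auto simp: Z_def)
      qed
      then have "prob (\<Inter>j\<in>?J. Z j -` A j \<inter> space M) =
          prob (\<Inter>i\<in>I. a i -` A (True, i) \<inter> space M) * prob (\<Inter>i\<in>I. b i -` A (False, i) \<inter> space M)"
        using indep_varD[OF ab X X, of True False] unfolding eq1 eq2 by simp
      also have "prob (\<Inter>i\<in>I. a i -` A (True, i) \<inter> space M) = (\<Prod>i\<in>I. prob (a i -` A (True, i) \<inter> space M))"
        using a I A by (intro indep_varsD_finite[where M' = "\<lambda>_. borel"]) auto
      also have "prob (\<Inter>i\<in>I. b i -` A (False, i) \<inter> space M) = (\<Prod>i\<in>I. prob (b i -` A (False, i) \<inter> space M))"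
        using b I A by (intro indep_varsD_finite[where M' = "\<lambda>_. borel"]) auto
      also have "(\<Prod>i\<in>I. prob (a i -` A (True, i) \<inter> space M)) * (\<Prod>i\<in>I. prob (b i -` A (False, i) \<inter> space M)) =
          (\<Prod>c\<in>UNIV. \<Prod>i\<in>I. prob (Z (c, i) -` A (c, i) \<inter> space M))"
        by (simp add: UNIV_bool Z_def mult.commute)
      also have "\<dots> = (\<Prod>j\<in>?J. prob (Z j -` A j \<inter> space M))"
        by (simp add: prod.cartesian_product case_prod_unfold)
      finally show "prob (\<Inter>j\<in>?J. Z j -` A j \<inter> space M) = (\<Prod>j\<in>?J. prob (Z j -` A j \<inter> space M))" .
    qed
    show "sets borel = sigma_sets (space borel) (sets borel)" for j :: "bool \<times> 'i"
      by (rule sets.sigma_sets_eq[symmetric])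
    show "Int_stable (sets borel)" for j :: "bool \<times> 'i"
      by (auto simp: Int_stable_def)
    show "random_variable borel (Z j)" if "j \<in> ?J" for j
      using that am bm by (auto simp: Z_def)
    show "finite ?J" using I(1) by (intro finite_cartesian_product finite_class.finite_UNIV)
  qed (use I in auto)
  let ?K = "\<lambda>i. {(True, i), (False, i)}"
  have "indep_vars (\<lambda>i. \<Pi>\<^sub>M j\<in>?K i. borel) (\<lambda>i \<omega>. \<lambda>j\<in>?K i. Z j \<omega>) I"
    using Z by (rule indep_vars_restrict) (auto simp: disjoint_family_on_def)
  then have "indep_vars (\<lambda>_. borel) (\<lambda>i \<omega>. case_prod f ((\<lambda>j\<in>?K i. Z j \<omega>) (True, i), (\<lambda>j\<in>?K i. Z j \<omega>) (False, i))) I"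
  proof (rule indep_vars_compose2)
    fix i
    have "(\<lambda>g. (g (True, i), g (False, i))) \<in> (\<Pi>\<^sub>M j\<in>?K i. borel) \<rightarrow>\<^sub>M borel \<Otimes>\<^sub>M borel"
      by (intro measurable_Pair measurable_component_singleton) auto
    from measurable_compose[OF this f]
    show "(\<lambda>g. case_prod f (g (True, i), g (False, i))) \<in> (\<Pi>\<^sub>M j\<in>?K i. borel) \<rightarrow>\<^sub>M borel" .
  qed
  then show ?thesis by (simp add: Z_def)
qed

text \<open>If \<open>b\<close> is 0 or 1 and \<open>h 0 = 0\<close>, then
  \<open>h (c * b * a)\<close> equals \<open>b\<close> times \<open>h (c * a)\<close>, and
  independence splits the expectation.\<close>

lemma (in prob_space) sparse_entry_expectation:
  fixes a b :: "'a \<Rightarrow> complex" and \<xi> :: "'c \<Rightarrow> complex" and h :: "complex \<Rightarrow> complex"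
  assumes xi: "\<xi> \<in> borel_measurable N" and a: "a \<in> borel_measurable M" "distr M borel a = distr N borel \<xi>"
    and b: "b \<in> borel_measurable M" "distr M borel b = bernoulli_law p" and p: "0 \<le> p" "p \<le> 1"
    and ab: "indep_var borel a borel b"
    and h: "h \<in> borel_measurable borel" "h 0 = 0" and int: "integrable N (\<lambda>t. h (c * \<xi> t))"
  shows "integrable M (\<lambda>\<omega>. h (c * b \<omega> * a \<omega>))"
    and "expectation (\<lambda>\<omega>. h (c * b \<omega> * a \<omega>)) = complex_of_real p * (LINT t|N. h (c * \<xi> t))"
proof -
  define g where "g z = h (c * z)" for z
  have g: "g \<in> borel_measurable borel"
    unfolding g_def using h(1) by measurable
  have ga: "integrable M (\<lambda>\<omega>. g (a \<omega>))" "expectation (\<lambda>\<omega>. g (a \<omega>)) = (LINT t|N. g (\<xi> t))"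
    using integrable_distr_eq[OF a(1) g] integrable_distr_eq[OF xi g] integral_distr[OF a(1) g]
      integral_distr[OF xi g] int a(2) by (simp_all add: g_def)
  \<comment> \<open>\<open>b\<close> is given only through its law, so its two values are obtained
    almost surely, by transfer from the Bernoulli distribution.\<close>
  have AEb: "AE \<omega> in M. b \<omega> \<in> {0, 1}"
  proof -
    have "AE s in measure_pmf (bernoulli_pmf p). of_bool s \<in> {0 :: complex, 1}"
      by (intro AE_I2) auto
    then have "AE z in bernoulli_law p. z \<in> {0, 1}"
      unfolding bernoulli_law_def by (subst AE_distr_iff) auto
    then show ?thesis
      unfolding b(2)[symmetric] using b(1) by (subst (asm) AE_distr_iff) auto
  qed
  have intb: "integrable M b"
  proof (rule integrable_const_bound[OF _ b(1)])
    show "AE \<omega> in M. norm (b \<omega>) \<le> 1" using AEb by eventually_elim auto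
  qed
  have Eb: "expectation b = complex_of_real p"
  proof -
    have "expectation b = (LINT z|bernoulli_law p. z)"
      unfolding b(2)[symmetric] using b(1) by (subst integral_distr) auto
    also have "\<dots> = (LINT s|measure_pmf (bernoulli_pmf p). of_bool s)"
      unfolding bernoulli_law_def by (subst integral_distr) auto
    also have "\<dots> = complex_of_real p"
      using p by (subst integral_measure_pmf[of UNIV]) (auto simp: UNIV_bool scaleR_conv_of_real)
    finally show ?thesis .
  qed
  have "indep_var borel (g \<circ> a) borel (id \<circ> b)"
    using ab g by (rule indep_var_compose) simp
  then have ind: "indep_var borel (\<lambda>\<omega>. g (a \<omega>)) borel b" by (simp add: comp_def)
  have eq: "AE \<omega> in M. g (a \<omega>) * b \<omega> = h (c * b \<omega> * a \<omega>)"
    using AEb by eventually_elim (auto simp: g_def h(2))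
  have m1: "(\<lambda>\<omega>. g (a \<omega>) * b \<omega>) \<in> borel_measurable M"
    using a(1) b(1) g by measurable
  have m2: "(\<lambda>\<omega>. h (c * b \<omega> * a \<omega>)) \<in> borel_measurable M"
    using a(1) b(1) h(1) by measurable
  show "integrable M (\<lambda>\<omega>. h (c * b \<omega> * a \<omega>))"
    using indep_var_integrable[OF ind ga(1) intb] integrable_cong_AE[OF m1 m2 eq] by simp
  show "expectation (\<lambda>\<omega>. h (c * b \<omega> * a \<omega>)) = complex_of_real p * (LINT t|N. h (c * \<xi> t))"
    using integral_cong_AE[OF m1 m2 eq] indep_var_lebesgue_integral[OF ind ga(1) intb] ga(2) Eb
    by (simp add: g_def mult.commute)
qed

section \<open>Truncation of the sparse entries\<close>

lemma (in prob_space) expectation_centered_square_le: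
  fixes Y :: "'a \<Rightarrow> complex"
  assumes Y: "Y \<in> borel_measurable M" and sq: "integrable M (\<lambda>\<omega>. (cmod (Y \<omega>))\<^sup>2)"
  shows "expectation (\<lambda>\<omega>. (cmod (Y \<omega> - expectation Y))\<^sup>2) \<le> expectation (\<lambda>\<omega>. (cmod (Y \<omega>))\<^sup>2)"
proof -
  define \<mu> where "\<mu> = expectation Y"
  have "integrable M (\<lambda>\<omega>. cmod (Y \<omega>))"
    by (rule square_integrable_imp_integrable[OF _ sq]) (use Y in measurable)
  then have int: "integrable M Y" using Y by (rule integrable_norm_cancel)
  have eq: "(cmod (Y \<omega> - \<mu>))\<^sup>2 = (cmod (Y \<omega>))\<^sup>2 - 2 * Re (Y \<omega> * cnj \<mu>) + (cmod \<mu>)\<^sup>2" for \<omega>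
    unfolding cmod_power2 by (simp add: power2_eq_square algebra_simps)
  have intRe: "integrable M (\<lambda>\<omega>. Re (Y \<omega> * cnj \<mu>))" using int by (intro integrable_Re integrable_mult_left)
  have "expectation (\<lambda>\<omega>. Re (Y \<omega> * cnj \<mu>)) = Re (expectation (\<lambda>\<omega>. Y \<omega> * cnj \<mu>))"
    using int by (intro integral_Re integrable_mult_left)
  also have "\<dots> = (cmod \<mu>)\<^sup>2"
    by (simp add: \<mu>_def[symmetric] complex_norm_square[symmetric] del: of_real_power)
  finally have ERe: "expectation (\<lambda>\<omega>. Re (Y \<omega> * cnj \<mu>)) = (cmod \<mu>)\<^sup>2" .
  have "expectation (\<lambda>\<omega>. f \<omega> - 2 * g \<omega> + s) = expectation f - 2 * expectation g + s"
    if "integrable M f" "integrable M g" for f g and s :: real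
    using that by (simp add: prob_space)
  from this[OF sq intRe] have "expectation (\<lambda>\<omega>. (cmod (Y \<omega> - \<mu>))\<^sup>2) = expectation (\<lambda>\<omega>. (cmod (Y \<omega>))\<^sup>2) - (cmod \<mu>)\<^sup>2"
    unfolding eq ERe by simp
  then show ?thesis by (simp add: \<mu>_def)
qed

text \<open>The Lindeberg tail of \<open>\<xi>\<close> for the scale \<open>c\<close>, to be used
  with c = 1 / sqrt K_n. The number 1/4 is the truncation level for the scaled entries.\<close>

definition tail_moment :: "'c measure \<Rightarrow> ('c \<Rightarrow> complex) \<Rightarrow> real \<Rightarrow> real" where
  "tail_moment N \<xi> c = (LINT t|N. (cmod (\<xi> t))\<^sup>2 * indicator {z. cmod (c * z) > 1 / 4} (\<xi> t))"

text \<open>Dominated convergence with the square of \<open>\<xi>\<close> as majorant: for each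
  fixed outcome the indicator is eventually 0.\<close>

lemma tail_moment_tendsto_0:
  assumes xi: "\<xi> \<in> borel_measurable N" "integrable N (\<lambda>t. (cmod (\<xi> t))\<^sup>2)"
    and c: "c \<longlonglongrightarrow> 0"
  shows "(\<lambda>n. tail_moment N \<xi> (c n)) \<longlonglongrightarrow> 0"
proof -
  have "(\<lambda>n. tail_moment N \<xi> (c n)) \<longlonglongrightarrow> (LINT t|N. (0 :: real))"
    unfolding tail_moment_def
  proof (rule integral_dominated_convergence[where w = "\<lambda>t. (cmod (\<xi> t))\<^sup>2"])
    show "(\<lambda>t. (cmod (\<xi> t))\<^sup>2 * indicator {z. cmod (c n * z) > 1 / 4} (\<xi> t)) \<in> borel_measurable N" for n
      using xi(1) by measurable
    show "AE t in N. (\<lambda>n. (cmod (\<xi> t))\<^sup>2 * indicator {z. cmod (c n * z) > 1 / 4} (\<xi> t)) \<longlonglongrightarrow> (0 :: real)"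
    proof (rule AE_I2)
      fix t
      have "(\<lambda>n. cmod (complex_of_real (c n) * \<xi> t)) \<longlonglongrightarrow> cmod (complex_of_real 0 * \<xi> t)"
        using c by (intro tendsto_intros)
      then have "\<forall>\<^sub>F n in sequentially. cmod (complex_of_real (c n) * \<xi> t) < 1 / 4"
        by (rule order_tendstoD) simp
      then have "\<forall>\<^sub>F n in sequentially. (cmod (\<xi> t))\<^sup>2 * indicator {z. cmod (c n * z) > 1 / 4} (\<xi> t) = (0 :: real)"
        by eventually_elim simp
      then show "(\<lambda>n. (cmod (\<xi> t))\<^sup>2 * indicator {z. cmod (c n * z) > 1 / 4} (\<xi> t)) \<longlonglongrightarrow> (0 :: real)"
        by (rule tendsto_eventually)
    qed
    show "AE t in N. norm ((cmod (\<xi> t))\<^sup>2 * indicator {z. cmod (c n * z) > 1 / 4} (\<xi> t)) \<le> (cmod (\<xi> t))\<^sup>2" for n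
      by (intro AE_I2) (simp add: indicator_def)
  qed (use xi in auto)
  then show ?thesis by simp
qed

text \<open>\<open>\<phi>\<close> cuts the scaled entry at the fixed level 1/4 and subtracts the
  resulting mean. Centring does not increase second moments, which serves both for
  \<open>\<phi>\<close> itself and for the error, whose square expectation is the tail moment times
  1/n.\<close>

lemma (in prob_space) sparse_array_truncated:
  fixes a b :: "nat \<times> nat \<Rightarrow> 'a \<Rightarrow> complex" and \<xi> :: "'c \<Rightarrow> complex"
  assumes N: "prob_space N" and xi: "\<xi> \<in> borel_measurable N" "integrable N \<xi>" "(LINT t|N. \<xi> t) = 0"
      "integrable N (\<lambda>t. (cmod (\<xi> t))\<^sup>2)" "(LINT t|N. (cmod (\<xi> t))\<^sup>2) = 1"
    and n: "n > 0" and k: "0 < k" "k \<le> n"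
    and a: "indep_vars (\<lambda>_. borel) a (entries n)" "\<And>p. p \<in> entries n \<Longrightarrow> distr M borel (a p) = distr N borel \<xi>"
    and b: "indep_vars (\<lambda>_. borel) b (entries n)" "\<And>p. p \<in> entries n \<Longrightarrow> distr M borel (b p) = bernoulli_law (real k / real n)"
    and ab: "indep_var (\<Pi>\<^sub>M p\<in>entries n. borel) (\<lambda>\<omega>. \<lambda>p\<in>entries n. a p \<omega>)
      (\<Pi>\<^sub>M p\<in>entries n. borel) (\<lambda>\<omega>. \<lambda>p\<in>entries n. b p \<omega>)"
  shows "\<exists>\<phi>. truncated_array M n (\<lambda>p \<omega>. complex_of_real (1 / sqrt k) * b p \<omega> * a p \<omega>) \<phi>
    (tail_moment N \<xi> (1 / sqrt k))"
proof -
  define c where "c = 1 / sqrt k"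
  have c: "c > 0" "c\<^sup>2 = 1 / k" using k by (simp_all add: c_def power_divide)
  define x where "x p \<omega> = complex_of_real c * b p \<omega> * a p \<omega>" for p \<omega>
  define q where "q = real k / real n"
  have q: "0 \<le> q" "q \<le> 1" using k n by (simp_all add: q_def)
  have qc: "q * c\<^sup>2 = 1 / n" using k by (simp add: q_def c)
  have fin: "finite (entries n)" and ne: "entries n \<noteq> {}" using n by (auto simp: entries_def)
  have am: "a p \<in> borel_measurable M" and bm: "b p \<in> borel_measurable M" if "p \<in> entries n" for p
    using a(1) b(1) that by (auto simp: indep_vars_def)
  have abp: "indep_var borel (a p) borel (b p)" if p: "p \<in> entries n" for p
  proof -
    have proj: "(\<lambda>g. g p) \<in> (\<Pi>\<^sub>M p\<in>entries n. borel) \<rightarrow>\<^sub>M (borel :: complex measure)"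
      using p by (rule measurable_component_singleton)
    have "indep_var borel ((\<lambda>g. g p) \<circ> (\<lambda>\<omega>. \<lambda>p\<in>entries n. a p \<omega>)) borel ((\<lambda>g. g p) \<circ> (\<lambda>\<omega>. \<lambda>p\<in>entries n. b p \<omega>))"
      by (rule indep_var_compose[OF ab proj proj])
    then show ?thesis using p by (simp add: comp_def)
  qed
  have xm: "x p \<in> borel_measurable M" if "p \<in> entries n" for p
    unfolding x_def[abs_def] using am[OF that] bm[OF that] by measurable
  have E: "integrable M (\<lambda>\<omega>. h (x p \<omega>))" "expectation (\<lambda>\<omega>. h (x p \<omega>)) = complex_of_real q * (LINT t|N. h (c * \<xi> t))"
    if p: "p \<in> entries n" and h: "h \<in> borel_measurable borel" "h 0 = 0" "integrable N (\<lambda>t. h (c * \<xi> t))"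
    for p and h :: "complex \<Rightarrow> complex"
    using sparse_entry_expectation[OF xi(1) am[OF p] a(2)[OF p] bm[OF p] b(2)[OF p] _ _ abp[OF p] h] q
    unfolding x_def q_def by simp_all
  have ER: "integrable M (\<lambda>\<omega>. h (x p \<omega>))" "expectation (\<lambda>\<omega>. h (x p \<omega>)) = q * (LINT t|N. h (c * \<xi> t))"
    if p: "p \<in> entries n" and h: "h \<in> borel_measurable borel" "h 0 = 0" "integrable N (\<lambda>t. h (c * \<xi> t))"
    for p and h :: "complex \<Rightarrow> real"
  proof -
    have "(\<lambda>z. complex_of_real (h z)) \<in> borel_measurable borel" using h(1) by measurable
    moreover have "integrable N (\<lambda>t. complex_of_real (h (c * \<xi> t)))" using h(3) by (rule integrable_of_real)
    ultimately have *: "integrable M (\<lambda>\<omega>. complex_of_real (h (x p \<omega>)))"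
      "expectation (\<lambda>\<omega>. complex_of_real (h (x p \<omega>))) = complex_of_real q * (LINT t|N. complex_of_real (h (c * \<xi> t)))"
      using E[OF p, of "\<lambda>z. complex_of_real (h z)"] h(2) by auto
    show "integrable M (\<lambda>\<omega>. h (x p \<omega>))" using *(1) by (simp only: complex_of_real_integrable_eq)
    have "complex_of_real (expectation (\<lambda>\<omega>. h (x p \<omega>))) = complex_of_real (q * (LINT t|N. h (c * \<xi> t)))"
      using *(2) by (simp only: integral_complex_of_real of_real_mult)
    then show "expectation (\<lambda>\<omega>. h (x p \<omega>)) = q * (LINT t|N. h (c * \<xi> t))"
      by (simp only: of_real_eq_iff)
  qed
  have sqc: "(cmod (c * z))\<^sup>2 = c\<^sup>2 * (cmod z)\<^sup>2" for z :: complex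
    by (simp add: norm_mult power_mult_distrib)
  have sq_int: "integrable M (\<lambda>\<omega>. (cmod (x p \<omega>))\<^sup>2)" and sq_le: "expectation (\<lambda>\<omega>. (cmod (x p \<omega>))\<^sup>2) = 1 / n"
    if "p \<in> entries n" for p
  proof -
    have i: "integrable N (\<lambda>t. (cmod (c * \<xi> t))\<^sup>2)" unfolding sqc using xi(4) by simp
    note * = ER[OF that, of "\<lambda>z. (cmod z)\<^sup>2", OF _ _ i]
    show "integrable M (\<lambda>\<omega>. (cmod (x p \<omega>))\<^sup>2)" by (rule *(1)) auto
    have "expectation (\<lambda>\<omega>. (cmod (x p \<omega>))\<^sup>2) = q * (LINT t|N. (cmod (c * \<xi> t))\<^sup>2)"
      by (rule *(2)) auto
    then show "expectation (\<lambda>\<omega>. (cmod (x p \<omega>))\<^sup>2) = 1 / n"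
      unfolding sqc using xi(5) qc by simp
  qed
  \<comment> \<open>Both \<open>\<psi>\<close> and its mean are at most 1/4 in modulus, so the
    recentred value stays below 1. The value 0 at 0 lets \<open>sparse_entry_expectation\<close>
    apply.\<close>
  define \<psi> where "\<psi> z = (if cmod z \<le> 1 / 4 then z else 0)" for z :: complex
  have psi_m: "\<psi> \<in> borel_measurable borel" unfolding \<psi>_def by measurable
  have psi_b: "cmod (\<psi> z) \<le> 1 / 4" for z by (simp add: \<psi>_def)
  define \<mu> where "\<mu> = complex_of_real q * (LINT t|N. \<psi> (c * \<xi> t))"
  define \<phi> where "\<phi> z = \<psi> z - \<mu>" for z
  have psi_int: "integrable M (\<lambda>\<omega>. \<psi> (x p \<omega>))" and psi_mean: "expectation (\<lambda>\<omega>. \<psi> (x p \<omega>)) = \<mu>"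
    if "p \<in> entries n" for p
  proof -
    interpret N: prob_space N by (rule N)
    have i: "integrable N (\<lambda>t. \<psi> (c * \<xi> t))"
    proof (rule N.integrable_const_bound[where B = "1 / 4"])
      show "(\<lambda>t. \<psi> (c * \<xi> t)) \<in> borel_measurable N" using psi_m xi(1) by measurable
    qed (intro AE_I2 psi_b)
    have "\<psi> 0 = 0" by (simp add: \<psi>_def)
    from E[OF that psi_m this i]
    show "integrable M (\<lambda>\<omega>. \<psi> (x p \<omega>))" "expectation (\<lambda>\<omega>. \<psi> (x p \<omega>)) = \<mu>"
      by (simp_all add: \<mu>_def)
  qed
  have mean: "integrable M (x p)" "expectation (x p) = 0" if "p \<in> entries n" for p
    using E[OF that, of "\<lambda>z. z"] xi(2,3) by simp_all
  \<comment> \<open>\<open>\<mu>\<close> is the mean at every position; any one of them exhibits it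
    as an expectation of a variable bounded by 1/4.\<close>
  obtain p0 where p0: "p0 \<in> entries n" using ne by blast
  have mu_b: "cmod \<mu> \<le> 1 / 4"
  proof -
    have "cmod \<mu> \<le> expectation (\<lambda>\<omega>. cmod (\<psi> (x p0 \<omega>)))"
      unfolding psi_mean[OF p0, symmetric] by (rule integral_norm_bound)
    also have "\<dots> \<le> expectation (\<lambda>_. 1 / 4)"
      using psi_int[OF p0] psi_b by (intro integral_mono integrable_norm) auto
    finally show ?thesis by (simp add: prob_space)
  qed
  have "truncated_array M n x \<phi> (tail_moment N \<xi> c)"
  proof (intro truncated_array.intro truncated_array_axioms.intro prob_space_axioms)
    show "n > 0" by (rule n)
    show "tail_moment N \<xi> c \<ge> 0" unfolding tail_moment_def by (intro integral_nonneg_AE AE_I2) auto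
    have "(\<lambda>(s, t). complex_of_real c * t * s) \<in> borel_measurable (borel \<Otimes>\<^sub>M borel)" by measurable
    from indep_vars_combine_arrays[OF fin ne a(1) b(1) ab this]
    show "indep_vars (\<lambda>_. borel) x (entries n)" unfolding x_def[abs_def] by simp
    show "\<phi> \<in> borel_measurable borel" unfolding \<phi>_def[abs_def] using psi_m by measurable
    show "cmod (\<phi> z) \<le> 1" for z
      unfolding \<phi>_def using norm_triangle_ineq4[of "\<psi> z" \<mu>] psi_b[of z] mu_b by linarith
    fix p assume p: "p \<in> entries n"
    show "integrable M (\<lambda>\<omega>. (cmod (x p \<omega>))\<^sup>2)" by (rule sq_int[OF p])
    show "expectation (x p) = 0" by (rule mean(2)[OF p])
    show "expectation (\<lambda>\<omega>. (cmod (x p \<omega>))\<^sup>2) \<le> 1 / n" by (simp add: sq_le[OF p])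
    show "expectation (\<lambda>\<omega>. \<phi> (x p \<omega>)) = 0"
      unfolding \<phi>_def using psi_int[OF p] psi_mean[OF p] by (simp add: prob_space)
    have pm: "(\<lambda>\<omega>. \<psi> (x p \<omega>)) \<in> borel_measurable M" using psi_m xm[OF p] by measurable
    have psq: "integrable M (\<lambda>\<omega>. (cmod (\<psi> (x p \<omega>)))\<^sup>2)"
    proof (rule integrable_const_bound[where B = 1])
      have "(cmod (\<psi> z))\<^sup>2 \<le> 1" for z using psi_b[of z] by (intro power_le_one) auto
      then show "AE \<omega> in M. norm ((cmod (\<psi> (x p \<omega>)))\<^sup>2) \<le> 1" by simp
    qed (use pm in measurable)
    have "expectation (\<lambda>\<omega>. (cmod (\<phi> (x p \<omega>)))\<^sup>2) \<le> expectation (\<lambda>\<omega>. (cmod (\<psi> (x p \<omega>)))\<^sup>2)"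
      using expectation_centered_square_le[OF pm psq] unfolding \<phi>_def psi_mean[OF p] .
    also have "\<dots> \<le> expectation (\<lambda>\<omega>. (cmod (x p \<omega>))\<^sup>2)"
      using psq sq_int[OF p] by (rule integral_mono) (simp add: \<psi>_def)
    finally show "expectation (\<lambda>\<omega>. (cmod (\<phi> (x p \<omega>)))\<^sup>2) \<le> 1 / n" by (simp add: sq_le[OF p])
    let ?d = "\<lambda>z. z - \<psi> z"
    have dm: "(\<lambda>\<omega>. ?d (x p \<omega>)) \<in> borel_measurable M" using pm xm[OF p] by measurable
    have d_sq: "(cmod (?d z))\<^sup>2 = (cmod z)\<^sup>2 * indicator {z. cmod z > 1 / 4} z" for z
      by (simp add: \<psi>_def indicator_def)
    have d_meas: "(\<lambda>z. (cmod (?d z))\<^sup>2) \<in> borel_measurable borel" using psi_m by measurable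
    have i: "integrable N (\<lambda>t. (cmod (?d (c * \<xi> t)))\<^sup>2)"
    proof (rule Bochner_Integration.integrable_bound)
      show "integrable N (\<lambda>t. (cmod (c * \<xi> t))\<^sup>2)" unfolding sqc using xi(4) by simp
      show "(\<lambda>t. (cmod (?d (c * \<xi> t)))\<^sup>2) \<in> borel_measurable N" using psi_m xi(1) by measurable
    qed (simp add: \<psi>_def)
    have "?d 0 = 0" by (simp add: \<psi>_def)
    then have "(cmod (?d 0))\<^sup>2 = 0" by simp
    note d = ER[OF p d_meas this i]
    \<comment> \<open>As the entry has mean zero, x - \<phi>(x) is the discarded part minus its own
      mean, so the centring inequality applies once more.\<close>
    have "expectation (\<lambda>\<omega>. ?d (x p \<omega>)) = - \<mu>"
      using mean[OF p] psi_int[OF p] psi_mean[OF p] by simp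
    then have "expectation (\<lambda>\<omega>. (cmod (x p \<omega> - \<phi> (x p \<omega>)))\<^sup>2) \<le> expectation (\<lambda>\<omega>. (cmod (?d (x p \<omega>)))\<^sup>2)"
      using expectation_centered_square_le[OF dm d(1)] by (simp add: \<phi>_def algebra_simps)
    also have "\<dots> = q * (LINT t|N. (cmod (?d (c * \<xi> t)))\<^sup>2)" by (rule d(2))
    also have "(\<lambda>t. (cmod (?d (c * \<xi> t)))\<^sup>2) =
        (\<lambda>t. c\<^sup>2 * ((cmod (\<xi> t))\<^sup>2 * indicator {z. cmod (c * z) > 1 / 4} (\<xi> t)))"
      unfolding d_sq sqc by (simp add: indicator_def mult.assoc)
    also have "q * (LINT t|N. c\<^sup>2 * ((cmod (\<xi> t))\<^sup>2 * indicator {z. cmod (c * z) > 1 / 4} (\<xi> t))) =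
        q * c\<^sup>2 * tail_moment N \<xi> c"
      by (simp add: tail_moment_def)
    finally show "expectation (\<lambda>\<omega>. (cmod (x p \<omega> - \<phi> (x p \<omega>)))\<^sup>2) \<le> tail_moment N \<xi> c / n"
      by (simp add: qc)
  qed
  then show ?thesis unfolding x_def[abs_def] c_def by blast
qed

theorem corollary1p3:
  fixes N :: "'c measure" and \<xi> :: "'c \<Rightarrow> complex"
    and M :: "nat \<Rightarrow> 'a measure"
    and A B :: "nat \<Rightarrow> nat \<Rightarrow> nat \<Rightarrow> 'a \<Rightarrow> complex"
    and K :: "nat \<Rightarrow> nat"
    and \<epsilon> :: real
  assumes "prob_space N" and "\<xi> \<in> borel_measurable N"
    and "integrable N \<xi>" and "(LINT x|N. \<xi> x) = 0"
    and "integrable N (\<lambda>x. (cmod (\<xi> x))\<^sup>2)" and "(LINT x|N. (cmod (\<xi> x))\<^sup>2) = 1"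
    and "\<And>n. n \<ge> 1 \<Longrightarrow> 1 \<le> K n \<and> K n \<le> n"
    and "\<And>n. n \<ge> 1 \<Longrightarrow> prob_space (M n)"
    and "\<And>n. n \<ge> 1 \<Longrightarrow>
           prob_space.indep_vars (M n) (\<lambda>_. borel) (\<lambda>(i, j). A n i j) (entries n)"
    and "\<And>n i j. i < n \<Longrightarrow> j < n \<Longrightarrow> distr (M n) borel (A n i j) = distr N borel \<xi>"
    and "\<And>n. n \<ge> 1 \<Longrightarrow>
           prob_space.indep_vars (M n) (\<lambda>_. borel) (\<lambda>(i, j). B n i j) (entries n)"
    and "\<And>n i j. i < n \<Longrightarrow> j < n \<Longrightarrow>
           distr (M n) borel (B n i j) = bernoulli_law (real (K n) / real n)"
    and "\<And>n. n \<ge> 1 \<Longrightarrow>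
           prob_space.indep_var (M n) (\<Pi>\<^sub>M p\<in>entries n. borel) (array n (A n))
             (\<Pi>\<^sub>M p\<in>entries n. borel) (array n (B n))"
    and "filterlim K at_top sequentially"
    and "\<epsilon> > 0"
  shows "(\<lambda>n. measure (M n) {\<omega> \<in> space (M n).
            spectral_radius (sparse_mat n (K n) (\<lambda>i j. B n i j \<omega>) (\<lambda>i j. A n i j \<omega>)) > 1 + \<epsilon>})
         \<longlonglongrightarrow> 0"
proof -
  define a where "a n = (\<lambda>(i, j). A n i j)" for n
  define b where "b n = (\<lambda>(i, j). B n i j)" for n
  define \<tau> where "\<tau> n = tail_moment N \<xi> (1 / sqrt (K n))" for n
  define r where "r = 1 / (1 + \<epsilon>)"
  define G where "G = suminf (majorant r)"
  let ?f = "\<lambda>n. measure (M n) {\<omega> \<in> space (M n).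
            spectral_radius (sparse_mat n (K n) (\<lambda>i j. B n i j \<omega>) (\<lambda>i j. A n i j \<omega>)) > 1 + \<epsilon>}"
  have r: "0 < r" "r < 1" "1 / r = 1 + \<epsilon>" using \<open>\<epsilon> > 0\<close> by (simp_all add: r_def)
  have G0: "G \<ge> 0"
    unfolding G_def using r by (intro suminf_nonneg summable_majorant majorant_nonneg) auto
  have bound: "?f n \<le> G / L + exp L * ((\<Sum>i. majorant r (i + m)) + sqrt (\<tau> n) * G)"
    if n: "n \<ge> 1" "2 ^ (2 * m * (2 * m)) \<le> n" and L: "L > 0" for n m :: nat and L
  proof -
    interpret prob_space "M n" by (rule assms(8)[OF n(1)])
    have arr: "array n (A n) = (\<lambda>\<omega>. \<lambda>p\<in>entries n. a n p \<omega>)" "array n (B n) = (\<lambda>\<omega>. \<lambda>p\<in>entries n. b n p \<omega>)"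
      by (auto simp: array_def a_def b_def fun_eq_iff restrict_def)
    have dist: "distr (M n) borel (a n p) = distr N borel \<xi>"
      "distr (M n) borel (b n p) = bernoulli_law (real (K n) / real n)" if "p \<in> entries n" for p
      using that assms(10,12) by (auto simp: a_def b_def entries_def)
    obtain \<phi> where ta: "truncated_array (M n) n
        (\<lambda>p \<omega>. complex_of_real (1 / sqrt (K n)) * b n p \<omega> * a n p \<omega>) \<phi> (\<tau> n)"
      using sparse_array_truncated[OF assms(1-6) _ _ _ assms(9)[OF n(1), folded a_def] dist(1)
          assms(11)[OF n(1), folded b_def] dist(2) assms(13)[OF n(1), unfolded arr]] assms(7)[OF n(1)] n(1)
      unfolding \<tau>_def by auto
    have "mat n n (\<lambda>p. complex_of_real (1 / sqrt (K n)) * b n p \<omega> * a n p \<omega>) =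
        sparse_mat n (K n) (\<lambda>i j. B n i j \<omega>) (\<lambda>i j. A n i j \<omega>)" for \<omega>
      unfolding sparse_mat_def a_def b_def by (rule cong_mat) auto
    then show ?thesis
      using truncated_array.prob_spectral_radius_le[OF ta r(1,2) n(2) L] unfolding r(3) G_def by simp
  qed
  \<comment> \<open>The divergence of \<open>K\<close> enters only here, through the Lindeberg
    tail.\<close>
  have "(\<lambda>n. 1 / sqrt (K n)) \<longlonglongrightarrow> 0"
    by (intro tendsto_divide_0[OF tendsto_const] filterlim_at_top_imp_at_infinity filterlim_compose[OF sqrt_at_top]
        filterlim_compose[OF filterlim_real_sequentially assms(14)])
  then have tau: "\<tau> \<longlonglongrightarrow> 0"
    unfolding \<tau>_def[abs_def] by (rule tail_moment_tendsto_0[OF assms(2,5)])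
  show ?thesis
  proof (rule LIMSEQ_I)
    fix \<eta> :: real assume eta: "\<eta> > 0"
    \<comment> \<open>This makes the Markov term \<open>G / L\<close> smaller than \<eta>/3.\<close>
    define L where "L = 3 * G / \<eta> + 1"
    have L: "L > 0" using G0 eta by (simp add: L_def add_nonneg_pos)
    have GL: "G / L < \<eta> / 3" using L eta by (simp add: L_def field_simps)
    \<comment> \<open>The tail of the majorant and the truncation error, each below \<delta>, cost
      \<eta>/3 apiece after multiplication by \<open>exp L\<close>. L is already fixed, so
      \<open>m\<close> and then \<open>n\<close> can be adapted to it.\<close>
    define \<delta> where "\<delta> = \<eta> / (3 * exp L)"
    have delta: "\<delta> > 0" using eta by (simp add: \<delta>_def)
    obtain m where m: "norm (\<Sum>i. majorant r (i + m)) < \<delta>"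
      using suminf_exist_split[OF delta summable_majorant[OF r(1,2)]] by blast
    have "(\<lambda>n. sqrt (\<tau> n) * G) \<longlonglongrightarrow> sqrt 0 * G" using tau by (intro tendsto_intros)
    then have "\<forall>\<^sub>F n in sequentially. sqrt (\<tau> n) * G < \<delta>"
      using delta by (intro order_tendstoD(2)) auto
    then obtain n0 where n0: "\<And>n. n \<ge> n0 \<Longrightarrow> sqrt (\<tau> n) * G < \<delta>"
      by (auto simp: eventually_sequentially)
    show "\<exists>n1. \<forall>n\<ge>n1. norm (?f n - 0) < \<eta>"
    proof (intro exI[of _ "max n0 (max 1 (2 ^ (2 * m * (2 * m))))"] allI impI)
      fix n assume "max n0 (max 1 (2 ^ (2 * m * (2 * m)))) \<le> n"
      then have n: "n \<ge> n0" "n \<ge> 1" "2 ^ (2 * m * (2 * m)) \<le> n" by (simp_all only: max.bounded_iff)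
      have "?f n \<le> G / L + exp L * ((\<Sum>i. majorant r (i + m)) + sqrt (\<tau> n) * G)"
        by (rule bound[OF n(2,3) L])
      also have "\<dots> < \<eta> / 3 + exp L * (\<delta> + \<delta>)"
        using GL m n0[OF n(1)] by (intro add_strict_mono mult_strict_left_mono) auto
      also have "\<dots> = \<eta>" by (simp add: \<delta>_def)
      finally show "norm (?f n - 0) < \<eta>" by simp
    qed
  qed
qed

end
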